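(* Let $X$ be a (real) normed space. Then the following statements hold: (i) Assume that the completion of $X$ is an Asplund space. Let $\tau$ be a locally convex topology on $X$ compatible with the duality (i.e. $(X,\tau)^*=(X,\|\cdot\|)^*$). Then $(X,\tau)$ has the weak-AFPP. (ii) If $(X^*,w^* )$ is $\aleph_0$-monolithic (i.e., each separable subset of $(X^*,w^* )$ has a countable network), then $(X^*,\|\cdot\|)$ has the $\sigma(X^*,X)$-AFPP.
   Context: Vector spaces are real. For a Hausdorff topological vector space $(E,\tau)$ with topological dual $E^*$ and a linear subspace $Z\subset E^*$, a nonempty bounded, closed, convex set $C\subset E$ has the $\sigma(E,Z)$-approximate fixed point property ($\sigma(E,Z)$-AFPP) if for every $\tau$-continuous mapping $f\colon C\to C$ there is a sequence $(x_n)$ in $C$ such that $x^*(x_n-f(x_n))\to 0$ for all $x^*\in Z$. The space $E$ has the $\sigma(E,Z)$-AFPP if every nonempty bounded closed convex subset of $E$ has it. The weak-AFPP is the $\sigma(E,E^* )$-AFPP. In (ii) this is applied with $E=X^*$ equipped with the dual norm topology (so "bounded", "closed" and "continuous" refer to the norm) and $Z=X$ regarded canonically as a subspace of $X^{**}$. $w^*$ denotes the weak* topology $\sigma(X^*,X)$. A Banach space is Asplund if each of its separable subspaces has a separable dual. A network of a topological space is a family $\mathcal N$ of subsets such that every open set is a union of members of $\mathcal N$; a subset has a countable network if it does so in its subspace topology. *)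

theory Defs
  imports "HOL-Analysis.Analysis"
begin

definition tvs :: "'a::real_vector topology \<Rightarrow> bool" where
  "tvs \<tau> \<longleftrightarrow>
     topspace \<tau> = UNIV \<and>
     continuous_map (prod_topology \<tau> \<tau>) \<tau> (\<lambda>(x, y). x + y) \<and>
     continuous_map (prod_topology euclideanreal \<tau>) \<tau> (\<lambda>(c, x). c *\<^sub>R x)"

text \<open>The Hausdorff property is not built in. A locally convex topology with the same continuous
  linear functionals as a norm topology is automatically Hausdorff, since these functionals separate
  points.\<close>

definition locally_convex_tvs :: "'a::real_vector topology \<Rightarrow> bool" where
  "locally_convex_tvs \<tau> \<longleftrightarrow>
     tvs \<tau> \<and>
     (\<forall>U. openin \<tau> U \<and> 0 \<in> U \<longrightarrow> (\<exists>V. openin \<tau> V \<and> 0 \<in> V \<and> convex V \<and> V \<subseteq> U))"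

definition tvs_dual :: "'a::real_vector topology \<Rightarrow> ('a \<Rightarrow> real) set" where
  "tvs_dual \<tau> = {f. linear f \<and> continuous_map \<tau> euclideanreal f}"

definition tvs_bounded :: "'a::real_vector topology \<Rightarrow> 'a set \<Rightarrow> bool" where
  "tvs_bounded \<tau> C \<longleftrightarrow>
     (\<forall>U. openin \<tau> U \<and> 0 \<in> U \<longrightarrow> (\<exists>s>0. \<forall>t>s. C \<subseteq> (*\<^sub>R) t ` U))"

lemma tvs_dual_euclidean:
  "tvs_dual (euclidean :: 'a::real_normed_vector topology) = {f. bounded_linear f}"
proof -
  have "bounded_linear f" if lin: "linear f" and cont: "continuous_on UNIV f" for f :: "'a \<Rightarrow> real"
  proof -
    have "isCont f 0"
      using cont by (simp add: continuous_on_eq_continuous_at)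
    then obtain d where d: "d > 0" "\<And>x. norm x < d \<Longrightarrow> \<bar>f x\<bar> < 1"
      using linear_0[OF lin] unfolding continuous_at_eps_delta dist_norm
      by (metis diff_zero real_norm_def zero_less_one)
    have "norm (f x) \<le> norm x * (2 / d)" for x
    proof (cases "x = 0")
      case False
      have "\<bar>f ((d / (2 * norm x)) *\<^sub>R x)\<bar> < 1"
        using d(1) False by (intro d(2)) simp
      then have "(d / (2 * norm x)) * \<bar>f x\<bar> < 1"
        using d(1) by (simp add: linear_cmul[OF lin] abs_mult)
      then show ?thesis
        using d(1) False by (simp add: field_simps)
    qed (simp add: linear_0[OF lin])
    then show ?thesis
      unfolding bounded_linear_def bounded_linear_axioms_def using lin by blast
  qed
  then show ?thesis
    by (auto simp: tvs_dual_def bounded_linear.linear linear_continuous_on)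
qed

lemma tvs_bounded_euclidean:
  "tvs_bounded (euclidean :: 'a::real_normed_vector topology) C \<longleftrightarrow> bounded C"
proof
  assume "tvs_bounded euclidean C"
  then obtain s where s: "s > 0" "\<forall>t>s. C \<subseteq> (*\<^sub>R) t ` ball 0 1"
    unfolding tvs_bounded_def by (metis centre_in_ball open_ball open_openin zero_less_one)
  then have "C \<subseteq> (*\<^sub>R) (s + 1) ` ball 0 1"
    by simp
  moreover have "bounded ((*\<^sub>R) (s + 1) ` ball (0::'a) 1)"
    by (intro bounded_scaling bounded_ball)
  ultimately show "bounded C"
    by (rule bounded_subset[rotated])
next
  assume "bounded C"
  then obtain B where B: "B > 0" "\<And>x. x \<in> C \<Longrightarrow> norm x \<le> B"
    by (meson bounded_pos)
  show "tvs_bounded euclidean C"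
    unfolding tvs_bounded_def
  proof (intro allI impI)
    fix U :: "'a set"
    assume "openin euclidean U \<and> 0 \<in> U"
    then obtain e where e: "e > 0" "ball 0 e \<subseteq> U"
      by (meson open_contains_ball open_openin)
    have "x \<in> (*\<^sub>R) t ` U" if "t > B / e" "x \<in> C" for t x
    proof
      have t: "t > 0"
        using that(1) B(1) e(1) by (meson divide_pos_pos less_trans)
      then show "x = t *\<^sub>R (x /\<^sub>R t)"
        by simp
      have "norm x < t * e"
        using B(2)[OF that(2)] that(1) e(1) by (simp add: field_simps)
      then have "norm (x /\<^sub>R t) < e"
        using t by (simp add: field_simps)
      then show "x /\<^sub>R t \<in> U"
        using e(2) by auto
    qed
    then show "\<exists>s>0. \<forall>t>s. C \<subseteq> (*\<^sub>R) t ` U"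
      using B(1) e(1) by (intro exI[of _ "B / e"]) auto
  qed
qed

definition afpp_on :: "'a::real_vector topology \<Rightarrow> ('a \<Rightarrow> real) set \<Rightarrow> 'a set \<Rightarrow> bool" where
  "afpp_on \<tau> Z C \<longleftrightarrow>
     (\<forall>f. continuous_map (subtopology \<tau> C) (subtopology \<tau> C) f \<longrightarrow>
        (\<exists>x::nat \<Rightarrow> 'a. (\<forall>n. x n \<in> C) \<and>
           (\<forall>\<phi>\<in>Z. (\<lambda>n. \<phi> (x n - f (x n))) \<longlonglongrightarrow> 0)))"

definition afpp :: "'a::real_vector topology \<Rightarrow> ('a \<Rightarrow> real) set \<Rightarrow> bool" where
  "afpp \<tau> Z \<longleftrightarrow>
     (\<forall>C. C \<noteq> {} \<and> tvs_bounded \<tau> C \<and> closedin \<tau> C \<and> convex C \<longrightarrow> afpp_on \<tau> Z C)"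

abbreviation weak_afpp :: "'a::real_vector topology \<Rightarrow> bool" where
  "weak_afpp \<tau> \<equiv> afpp \<tau> (tvs_dual \<tau>)"

text \<open>The target type is required to be a Banach space, so an embedding of this kind exhibits it
  as the completion of the source, which is unique up to isometric isomorphism.\<close>

definition completion_embedding :: "('a::real_normed_vector \<Rightarrow> 'b::banach) \<Rightarrow> bool" where
  "completion_embedding J \<longleftrightarrow>
     linear J \<and> (\<forall>x. norm (J x) = norm x) \<and> closure (range J) = UNIV"

text \<open>A functional on a linear subspace \<open>M\<close> is represented by its extension by \<open>0\<close> outside \<open>M\<close>
  (not a linear map on the whole space).\<close>

definition subspace_dual :: "'b::real_normed_vector set \<Rightarrow> ('b \<Rightarrow> real) set" where
  "subspace_dual M =
     {f. (\<forall>x\<in>M. \<forall>y\<in>M. f (x + y) = f x + f y) \<and>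
         (\<forall>c. \<forall>x\<in>M. f (c *\<^sub>R x) = c * f x) \<and>
         (\<exists>K. \<forall>x\<in>M. \<bar>f x\<bar> \<le> K * norm x) \<and>
         (\<forall>x. x \<notin> M \<longrightarrow> f x = 0)}"

definition subspace_dual_norm :: "'b::real_normed_vector set \<Rightarrow> ('b \<Rightarrow> real) \<Rightarrow> real" where
  "subspace_dual_norm M f = (SUP x\<in>{x\<in>M. norm x \<le> 1}. \<bar>f x\<bar>)"

definition subspace_dual_separable :: "'b::real_normed_vector set \<Rightarrow> bool" where
  "subspace_dual_separable M \<longleftrightarrow>
     (\<exists>D. countable D \<and> D \<subseteq> subspace_dual M \<and>
        (\<forall>f\<in>subspace_dual M. \<forall>e>0. \<exists>g\<in>D. subspace_dual_norm M (\<lambda>x. f x - g x) < e))"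

definition asplund_space :: "'b::banach itself \<Rightarrow> bool" where
  "asplund_space _ \<longleftrightarrow>
     (\<forall>M::'b set. subspace M \<and> separable_space (top_of_set M) \<longrightarrow> subspace_dual_separable M)"

definition has_countable_network :: "'a topology \<Rightarrow> bool" where
  "has_countable_network T \<longleftrightarrow>
     (\<exists>\<N>. countable \<N> \<and> (\<forall>N\<in>\<N>. N \<subseteq> topspace T) \<and>
        (\<forall>U. openin T U \<longrightarrow> (\<exists>\<M>\<subseteq>\<N>. U = \<Union>\<M>)))"

definition aleph0_monolithic :: "'a topology \<Rightarrow> bool" where
  "aleph0_monolithic T \<longleftrightarrow>
     (\<forall>S\<subseteq>topspace T. separable_space (subtopology T S) \<longrightarrow>
        has_countable_network (subtopology T S))"

text \<open>For scalar-valued operators, the strong operator topology is the topology of pointwise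
  convergence of functionals.\<close>

abbreviation weak_star_topology :: "('a::real_normed_vector \<Rightarrow>\<^sub>L real) topology" where
  "weak_star_topology \<equiv> strong_operator_topology"

definition canonical_functionals :: "(('a::real_normed_vector \<Rightarrow>\<^sub>L real) \<Rightarrow> real) set" where
  "canonical_functionals = range (\<lambda>x \<phi>. blinfun_apply \<phi> x)"

end

theory Submission
  imports Defs
begin

text \<open>Fix a countable set \<open>A \<subseteq> C\<close> that is invariant under \<open>f\<close> and under convex combinations with
  rational weights. For finitely many functionals, a Schauder projection onto a finite net in \<open>A\<close>
  and Brouwer's theorem produce points \<open>a \<in> A\<close> at which all of them are small on \<open>a - f a\<close>; Kuhn's
  combinatorial lemma yields approximate fixed points with rational coordinates, which is what keeps
  \<open>a\<close> inside \<open>A\<close>. It remains to replace the family of all functionals by a sequence.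

  In (i), \<open>C\<close> is norm bounded by the uniform boundedness principle, and the restrictions of the
  functionals to the span of \<open>A\<close> form a subset of the dual of a separable subspace of the completion,
  so countably many of them are norm dense.

  In (ii), the weak* closure \<open>K\<close> of \<open>{a - f a | a. a \<in> A}\<close> is compact and separable, so it has a
  countable network. Choosing for each member of the network a vector on which no functional in that
  member vanishes, whenever there is one, gives countably many vectors that separate \<open>0\<close> from the
  rest of \<open>K\<close>; by compactness, convergence to \<open>0\<close> on these vectors implies weak* convergence to \<open>0\<close>.\<close>

section \<open>Approximate fixed points with rational coordinates\<close>

text \<open>Kuhn's lemma on a fine grid finds a cell in which both labels occur for every
  coordinate; uniform continuity then makes its corner \<open>T q\<close>, which is rational, almost
  fixed. The cube has infinitely many coordinates, so that \<open>n\<close> can stay an ordinary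
  variable; it is still compact, and the grid points vanish from coordinate \<open>n\<close>
  on.\<close>

lemma approximate_brouwer_rational:
  fixes g :: "(nat \<Rightarrow> real) \<Rightarrow> nat \<Rightarrow> real"
  defines "Q \<equiv> PiE UNIV (\<lambda>_::nat. {0..1::real})"
  assumes cont: "\<And>i. i < n \<Longrightarrow> continuous_on Q (\<lambda>t. g t i)"
    and ran: "\<And>i t. i < n \<Longrightarrow> t \<in> Q \<Longrightarrow> 0 \<le> g t i \<and> g t i \<le> 1"
    and "e > 0"
  obtains t where "t \<in> Q" "\<And>i. t i \<in> \<rat>" "\<And>i. i < n \<Longrightarrow> \<bar>g t i - t i\<bar> < e"
proof -
  have "compactin euclidean Q"
    unfolding Q_def euclidean_product_topology[symmetric]
    by (auto simp: compactin_PiE)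
  then have "compact Q" by simp
  have "\<exists>d>0. \<forall>s\<in>Q. \<forall>t\<in>Q. dist s t < d \<longrightarrow> \<bar>g s i - g t i\<bar> < e/2" if "i < n" for i
  proof -
    have "uniformly_continuous_on Q (\<lambda>t. g t i)"
      using compact_uniformly_continuous[OF cont[OF that] \<open>compact Q\<close>] .
    then show ?thesis
      unfolding uniformly_continuous_on_def using \<open>e > 0\<close>
      by (metis dist_real_def half_gt_zero_iff dist_commute)
  qed
  then obtain d where d: "\<And>i. i < n \<Longrightarrow> d i > 0"
    "\<And>i s t. i < n \<Longrightarrow> s \<in> Q \<Longrightarrow> t \<in> Q \<Longrightarrow> dist s t < d i \<Longrightarrow> \<bar>g s i - g t i\<bar> < e/2"
    by metis
  define \<delta> where "\<delta> = Min (insert 1 (d ` {..<n}))"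
  have "\<delta> > 0" using d(1) by (auto simp: \<delta>_def)
  have \<delta>: "\<bar>g s i - g t i\<bar> < e/2" if "i < n" "s \<in> Q" "t \<in> Q" "dist s t < \<delta>" for i s t
  proof -
    have "\<delta> \<le> d i" using that by (auto simp: \<delta>_def)
    then show ?thesis using d(2) that by force
  qed
  \<comment> \<open>The distance of neighbouring grid points is at most
    \<open>2 / p + (1/2)^N\<close>; each summand is made smaller than \<open>\<delta>/2\<close>. The
    bound \<open>1 / p < e/2\<close> pays for the step from a corner of the cell back to
    \<open>q\<close>.\<close>
  obtain N where N: "(1/2::real)^N < \<delta>/2"
    using real_arch_pow_inv[of "\<delta>/2" "1/2"] \<open>\<delta> > 0\<close> by auto
  obtain p where p: "p > 0" "1 / real p < min (\<delta>/4) (e/2)"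
    using real_arch_inverse[of "min (\<delta>/4) (e/2)"] \<open>\<delta> > 0\<close> \<open>e > 0\<close>
    by (metis half_gt_zero_iff inverse_eq_divide min_less_iff_conj zero_less_divide_iff zero_less_numeral gr0I)
  define T where "T v i = (if i < n then real (v i) / real p else 0)" for v :: "nat \<Rightarrow> nat" and i
  have TQ: "T v \<in> Q" if "\<forall>i<n. v i \<le> p" for v
    using that p(1) by (auto simp: T_def Q_def)
  have Tdist: "dist (T v) (T w) < \<delta>" if "\<forall>i<n. \<bar>real (v i) - real (w i)\<bar> \<le> 1" for v w
  proof -
    have le: "dist (T v i) (T w i) \<le> 1 / p" for i
      using that p(1) by (auto simp: T_def dist_real_def diff_divide_distrib[symmetric] divide_right_mono)
    have "dist (T v) (T w) \<le> 2 * Max {dist (T v (from_nat k)) (T w (from_nat k)) |k. k \<le> N} + (1/2)^N"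
      by (rule dist_fun_le_dist_first_terms)
    also have "Max {dist (T v (from_nat k)) (T w (from_nat k)) |k. k \<le> N} \<le> 1 / p"
      using le by (subst Max_le_iff) auto
    also have "2 * (1 / p) + (1/2)^N < \<delta>" using N p(2) by auto
    finally show ?thesis by simp
  qed
  \<comment> \<open>Kuhn labelling: coordinate \<open>i\<close> gets label 0 or 1 according to whether \<open>g\<close> pushes it up or down,
    with the labels on the faces of the cube forced.\<close>
  define label where "label v i = (if v i = 0 \<or> (v i \<noteq> p \<and> T v i \<le> g (T v) i) then 0 else 1::nat)" for v i
  have lab0: "T v i \<le> g (T v) i" if "label v i = 0" "i < n" "\<forall>i<n. v i \<le> p" for v i
    using that ran[OF that(2) TQ[OF that(3)]] by (auto simp: label_def T_def split: if_splits)
  have lab1: "g (T v) i \<le> T v i" if "label v i \<noteq> 0" "i < n" "\<forall>i<n. v i \<le> p" for v i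
    using that ran[OF that(2) TQ[OF that(3)]] p(1) by (auto simp: label_def T_def split: if_splits)
  obtain q where q: "\<forall>i<n. q i < p"
    "\<forall>i<n. \<exists>r s. (\<forall>j<n. q j \<le> r j \<and> r j \<le> q j + 1) \<and> (\<forall>j<n. q j \<le> s j \<and> s j \<le> q j + 1) \<and> label r i \<noteq> label s i"
    by (rule kuhn_lemma[of p n label]) (use p(1) in \<open>auto simp: label_def\<close>)
  have qp: "\<forall>i<n. q i \<le> p" using q(1) by (simp add: less_imp_le)
  have "\<bar>g (T q) i - T q i\<bar> < e" if i: "i < n" for i
  proof -
    \<comment> \<open>Only the labels 0 and 1 occur, so the two corners can be ordered:
      \<open>g\<close> does not push coordinate \<open>i\<close> down at \<open>r\<close> nor up at
      \<open>s\<close>.\<close>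
    have "\<exists>r s. (\<forall>j<n. q j \<le> r j \<and> r j \<le> q j + 1) \<and> (\<forall>j<n. q j \<le> s j \<and> s j \<le> q j + 1) \<and> label r i = 0 \<and> label s i \<noteq> 0"
    proof -
      obtain r s where rs: "\<forall>j<n. q j \<le> r j \<and> r j \<le> q j + 1" "\<forall>j<n. q j \<le> s j \<and> s j \<le> q j + 1"
        "label r i \<noteq> label s i"
        using q(2) i by blast
      show ?thesis
      proof (cases "label r i = 0")
        case True
        then show ?thesis using rs by (intro exI[of _ r] exI[of _ s]) simp
      next
        case False
        then have "label s i = 0" using rs(3) by (simp add: label_def split: if_splits)
        then show ?thesis using rs by (intro exI[of _ s] exI[of _ r]) simp
      qed
    qed
    then obtain r s where r: "\<forall>j<n. q j \<le> r j \<and> r j \<le> q j + 1" "label r i = 0"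
      and s: "\<forall>j<n. q j \<le> s j \<and> s j \<le> q j + 1" "label s i \<noteq> 0" by blast
    have rp: "\<forall>j<n. r j \<le> p" and sp: "\<forall>j<n. s j \<le> p"
      using q(1) r(1) s(1) by (force dest: Suc_leI)+
    have "dist (T q) (T r) < \<delta>" "dist (T q) (T s) < \<delta>"
      using r(1) s(1) by (auto intro!: Tdist simp: abs_if)
    then have "\<bar>g (T q) i - g (T r) i\<bar> < e/2" "\<bar>g (T q) i - g (T s) i\<bar> < e/2"
      using \<delta> that TQ qp rp sp by auto
    moreover have "T q i \<le> T r i" "T s i \<le> T q i + 1 / p"
      using r(1) s(1) that p(1)
      by (auto simp: T_def divide_right_mono simp flip: add_divide_distrib)
    moreover have "T r i \<le> g (T r) i" "g (T s) i \<le> T s i"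
      using lab0 lab1 r(2) s(2) rp sp that by auto
    \<comment> \<open>The corner \<open>r\<close> bounds \<open>g (T q) i\<close> from below by
      \<open>T q i - e/2\<close>, and \<open>s\<close> bounds it from above by
      \<open>T q i + 1 / p + e/2\<close>.\<close>
    ultimately show ?thesis using p(2) by linarith
  qed
  moreover have "T q i \<in> \<rat>" for i by (simp add: T_def)
  ultimately show ?thesis using TQ[OF qp] that by blast
qed

section \<open>Countable sets closed under rational convex combinations, and finite nets in
  them\<close>

definition rationally_convex :: "'a::real_vector set \<Rightarrow> bool" where
  "rationally_convex A \<longleftrightarrow>
     (\<forall>x\<in>A. \<forall>y\<in>A. \<forall>u\<in>\<rat> \<inter> {0..1}. (1 - u) *\<^sub>R x + u *\<^sub>R y \<in> A)"

text \<open>Split off one point and divide the other weights by their sum, which is rational; this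
  reduces the claim to two points.\<close>

lemma rationally_convex_sum:
  assumes A: "rationally_convex A" and "finite I"
    and "\<And>i. i \<in> I \<Longrightarrow> x i \<in> A" "\<And>i. i \<in> I \<Longrightarrow> r i \<in> \<rat>" "\<And>i. i \<in> I \<Longrightarrow> 0 \<le> r i" "sum r I = 1"
  shows "(\<Sum>i\<in>I. r i *\<^sub>R x i) \<in> A"
  using assms(2-)
proof (induction I arbitrary: r rule: finite_induct)
  case (insert i I)
  have sum: "r i + sum r I = 1" using insert by simp
  have pos: "0 \<le> sum r I" using insert.prems by (intro sum_nonneg) auto
  show ?case
  proof (cases "sum r I = 0")
    \<comment> \<open>Rescaling is impossible here, but then all the weight sits on the new
      point.\<close>
    case True
    then have "r j = 0" if "j \<in> I" for j
      using that insert sum_nonneg_eq_0_iff[of I r] by auto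
    then have "(\<Sum>j\<in>I. r j *\<^sub>R x j) = 0" by simp
    then show ?thesis using insert sum True by simp
  next
    case False
    define y where "y = (\<Sum>j\<in>I. (r j / sum r I) *\<^sub>R x j)"
    have "sum r I \<in> \<rat>" using insert.prems by (intro Rats_sum) auto
    then have "y \<in> A"
      unfolding y_def using insert.prems False pos
      by (intro insert.IH) (auto intro!: Rats_divide simp flip: sum_divide_distrib)
    then have "(1 - r i) *\<^sub>R y + r i *\<^sub>R x i \<in> A"
      using A insert.prems sum pos unfolding rationally_convex_def by auto
    moreover have "(1 - r i) *\<^sub>R y = (\<Sum>j\<in>I. r j *\<^sub>R x j)"
    proof -
      have "1 - r i = sum r I" using sum by simp
      then show ?thesis using False by (simp add: y_def scaleR_sum_right)
    qed
    ultimately show ?thesis using insert by (simp add: add.commute)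
  qed
qed simp

text \<open>Starting from one point, each stage adds the images under \<open>f\<close> and the
  rational binary combinations, and stays countable and inside \<open>C\<close>. The stages
  increase, so any two points of the union share a stage.\<close>

lemma countable_invariant_rationally_convex:
  assumes "C \<noteq> {}" "convex C" "f ` C \<subseteq> C"
  obtains A where "countable A" "A \<noteq> {}" "A \<subseteq> C" "f ` A \<subseteq> A" "rationally_convex A"
proof -
  obtain x0 where "x0 \<in> C" using assms(1) by blast
  define step where "step S = S \<union> f ` S \<union> (\<lambda>(u, x, y). (1 - u) *\<^sub>R x + u *\<^sub>R y) ` ((\<rat> \<inter> {0..1::real}) \<times> S \<times> S)" for S
  define B where "B n = (step ^^ n) {x0}" for n
  have BS: "B (Suc n) = step (B n)" for n by (simp add: B_def)
  have "B n \<subseteq> B (Suc n)" for n unfolding BS by (auto simp: step_def)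
  then have mono: "B m \<subseteq> B n" if "m \<le> n" for m n using that by (rule lift_Suc_mono_le)
  have cnt: "countable (B n)" for n
    by (induction n)
      (auto simp: BS step_def B_def intro!: countable_SIGMA countable_image countable_Int1 countable_rat)
  have sub: "B n \<subseteq> C" for n
  proof (induction n)
    case (Suc n)
    have "(1 - u) *\<^sub>R x + u *\<^sub>R y \<in> C" if "u \<in> {0..1}" "x \<in> B n" "y \<in> B n" for u x y
      using \<open>convex C\<close> Suc that by (auto simp: convex_alt)
    moreover have "f ` B n \<subseteq> C" using Suc assms(3) by blast
    ultimately show ?case using Suc by (auto simp: BS step_def)
  qed (simp add: B_def \<open>x0 \<in> C\<close>)
  show thesis
  proof
    show "countable (\<Union>n. B n)" using cnt by simp
    show "(\<Union>n. B n) \<noteq> {}" by (auto simp: B_def intro: exI[of _ 0])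
    show "(\<Union>n. B n) \<subseteq> C" using sub by blast
    have "f ` B n \<subseteq> B (Suc n)" for n unfolding BS by (auto simp: step_def)
    then show "f ` (\<Union>n. B n) \<subseteq> (\<Union>n. B n)" by blast
    show "rationally_convex (\<Union>n. B n)"
      unfolding rationally_convex_def
    proof (intro ballI)
      fix x y u assume xy: "x \<in> (\<Union>n. B n)" "y \<in> (\<Union>n. B n)" and u: "u \<in> \<rat> \<inter> {0..1::real}"
      then obtain m n where "x \<in> B m" "y \<in> B n" by blast
      then have "x \<in> B (max m n)" "y \<in> B (max m n)" using mono[of m "max m n"] mono[of n "max m n"] by auto
      then have "(1 - u) *\<^sub>R x + u *\<^sub>R y \<in> B (Suc (max m n))"
        using u unfolding BS step_def by (intro UnI2 image_eqI[of _ _ "(u, x, y)"]) auto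
      then show "(1 - u) *\<^sub>R x + u *\<^sub>R y \<in> (\<Union>n. B n)" by blast
    qed
  qed
qed

text \<open>Boundedness leaves only finitely many patterns of integer parts of
  \<open>\<phi> a / e\<close>; one representative of each pattern forms the net.\<close>

lemma finite_functional_net:
  fixes \<Phi> :: "('a \<Rightarrow> real) set"
  assumes "finite \<Phi>" "\<And>\<phi>. \<phi> \<in> \<Phi> \<Longrightarrow> bounded (\<phi> ` A)" "e > 0"
  obtains F where "finite F" "F \<subseteq> A" "\<And>a. a \<in> A \<Longrightarrow> \<exists>x\<in>F. \<forall>\<phi>\<in>\<Phi>. \<bar>\<phi> a - \<phi> x\<bar> < e"
proof -
  obtain B where B: "\<And>\<phi> a. \<phi> \<in> \<Phi> \<Longrightarrow> a \<in> A \<Longrightarrow> \<bar>\<phi> a\<bar> \<le> B \<phi>"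
    using assms(2) by (simp add: bounded_iff) metis
  define h where "h a = restrict (\<lambda>\<phi>. \<lfloor>\<phi> a / e\<rfloor>) \<Phi>" for a
  have "h a \<in> PiE \<Phi> (\<lambda>\<phi>. {\<lfloor>- B \<phi> / e\<rfloor>..\<lfloor>B \<phi> / e\<rfloor>})" if "a \<in> A" for a
  proof -
    have "- B \<phi> / e \<le> \<phi> a / e \<and> \<phi> a / e \<le> B \<phi> / e" if "\<phi> \<in> \<Phi>" for \<phi>
      using B[OF that \<open>a \<in> A\<close>] \<open>e > 0\<close> by (intro conjI divide_right_mono) auto
    then show ?thesis by (auto simp: h_def intro!: floor_mono)
  qed
  then have "h ` A \<subseteq> PiE \<Phi> (\<lambda>\<phi>. {\<lfloor>- B \<phi> / e\<rfloor>..\<lfloor>B \<phi> / e\<rfloor>})" by blast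
  then have fin: "finite (h ` A)"
    by (rule finite_subset) (auto intro!: finite_PiE assms(1))
  show thesis
  proof
    show "finite (inv_into A h ` (h ` A))" using fin by simp
    show "inv_into A h ` (h ` A) \<subseteq> A" by (auto intro: inv_into_into)
    fix a assume a: "a \<in> A"
    define x where "x = inv_into A h (h a)"
    have hx: "h x = h a" unfolding x_def using a by (intro f_inv_into_f) auto
    have "\<bar>\<phi> a - \<phi> x\<bar> < e" if "\<phi> \<in> \<Phi>" for \<phi>
    proof -
      have "\<lfloor>\<phi> a / e\<rfloor> = \<lfloor>\<phi> x / e\<rfloor>" using fun_cong[OF hx, of \<phi>] that by (simp add: h_def)
      then have "\<bar>\<phi> a / e - \<phi> x / e\<bar> < 1" by linarith
      then show ?thesis using \<open>e > 0\<close> by (simp add: divide_simps abs_less_iff flip: diff_divide_distrib)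
    qed
    then show "\<exists>x\<in>inv_into A h ` (h ` A). \<forall>\<phi>\<in>\<Phi>. \<bar>\<phi> a - \<phi> x\<bar> < e"
      using a by (intro bexI[of _ x]) (auto simp: x_def)
  qed
qed

section \<open>Schauder projection and almost fixed points for finitely many functionals\<close>

lemma continuous_map_tvs_sum:
  assumes "tvs \<tau>" "\<And>i. i < (m::nat) \<Longrightarrow> continuous_map X euclideanreal (r i)"
  shows "continuous_map X \<tau> (\<lambda>t. \<Sum>i<m. r i t *\<^sub>R x i)"
  using assms(2)
proof (induction m)
  case 0
  then show ?case using assms(1) by (simp add: tvs_def)
next
  case (Suc m)
  have top: "topspace \<tau> = UNIV" and add: "continuous_map (prod_topology \<tau> \<tau>) \<tau> (\<lambda>(x, y). x + y)"
    and scale: "continuous_map (prod_topology euclideanreal \<tau>) \<tau> (\<lambda>(c, x). c *\<^sub>R x)"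
    using assms(1) by (auto simp: tvs_def)
  have "continuous_map X (prod_topology euclideanreal \<tau>) (\<lambda>t. (r m t, x m))"
    using Suc.prems[of m] top by (intro continuous_map_pairedI) auto
  from continuous_map_compose[OF this scale]
  have "continuous_map X \<tau> (\<lambda>t. r m t *\<^sub>R x m)" by (simp add: o_def)
  then have "continuous_map X (prod_topology \<tau> \<tau>) (\<lambda>t. (\<Sum>i<m. r i t *\<^sub>R x i, r m t *\<^sub>R x m))"
    using Suc by (intro continuous_map_pairedI) auto
  from continuous_map_compose[OF this add] show ?case by (simp add: o_def)
qed

text \<open>The cube parametrizes convex combinations \<open>X t\<close> of a finite net, and
  \<open>g\<close> returns the Schauder weights of \<open>f (X t)\<close>. A rational almost fixed
  point \<open>t\<close> puts \<open>a = X t\<close>, hence also \<open>f a\<close>, into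
  \<open>A\<close>, where the net is effective. As seen by \<open>\<Phi>\<close>, both are then
  close to the combination of the net points with weights \<open>g t\<close>.\<close>

lemma approximate_fixed_point_finite_functionals:
  fixes f :: "'a::real_vector \<Rightarrow> 'a"
  assumes \<tau>: "tvs \<tau>" and C: "convex C" and f: "continuous_map (subtopology \<tau> C) (subtopology \<tau> C) f"
    and A: "A \<noteq> {}" "A \<subseteq> C" "f ` A \<subseteq> A" "rationally_convex A"
    and \<Phi>: "finite \<Phi>" "\<Phi> \<subseteq> tvs_dual \<tau>" "\<And>\<phi>. \<phi> \<in> \<Phi> \<Longrightarrow> bounded (\<phi> ` C)" and "e > 0"
  shows "\<exists>a\<in>A. \<forall>\<phi>\<in>\<Phi>. \<bar>\<phi> (a - f a)\<bar> < e"
proof -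
  \<comment> \<open>The final error is below \<open>3 * \<epsilon>\<close>: one
    \<open>\<epsilon>\<close> for the weights and \<open>2 * \<epsilon>\<close> for the radius of
    the Schauder projection.\<close>
  define \<epsilon> where "\<epsilon> = e / 4"
  have "\<epsilon> > 0" using \<open>e > 0\<close> by (simp add: \<epsilon>_def)
  have lin: "linear \<phi>" and cont\<phi>: "continuous_map \<tau> euclideanreal \<phi>" if "\<phi> \<in> \<Phi>" for \<phi>
    using that \<Phi>(2) by (auto simp: tvs_dual_def)
  have "bounded (\<phi> ` A)" if "\<phi> \<in> \<Phi>" for \<phi>
    using \<Phi>(3)[OF that] A(2) by (meson bounded_subset image_mono)
  then obtain F where F: "finite F" "F \<subseteq> A" "\<And>a. a \<in> A \<Longrightarrow> \<exists>x\<in>F. \<forall>\<phi>\<in>\<Phi>. \<bar>\<phi> a - \<phi> x\<bar> < \<epsilon>"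
    using finite_functional_net[OF \<Phi>(1) _ \<open>\<epsilon> > 0\<close>] by metis
  obtain m and x :: "nat \<Rightarrow> 'a" where x: "F = x ` {..<m}"
    using finite_imp_nat_seg_image_inj_on[OF F(1)] by (metis lessThan_def)
  have "F \<noteq> {}" using A(1) F(3) by blast
  then have "m > 0" using x by (cases m) auto
  have xA: "x i \<in> A" if "i < m" for i using that x F(2) by blast
  then have xC: "x i \<in> C" if "i < m" for i using that A(2) by blast
  \<comment> \<open>The summand 1 keeps \<open>M\<close> positive, as it will be a divisor.\<close>
  define M where "M = 1 + (\<Sum>\<phi>\<in>\<Phi>. \<Sum>i<m. \<bar>\<phi> (x i)\<bar>)"
  have M: "\<bar>\<phi> (x i)\<bar> \<le> M" if "\<phi> \<in> \<Phi>" "i < m" for \<phi> i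
  proof -
    have "\<bar>\<phi> (x i)\<bar> \<le> (\<Sum>i<m. \<bar>\<phi> (x i)\<bar>)"
      using that by (intro member_le_sum[where f = "\<lambda>i. \<bar>\<phi> (x i)\<bar>"]) auto
    also have "\<dots> \<le> (\<Sum>\<phi>\<in>\<Phi>. \<Sum>i<m. \<bar>\<phi> (x i)\<bar>)"
      using that \<Phi>(1) by (intro member_le_sum[where f = "\<lambda>\<phi>. \<Sum>i<m. \<bar>\<phi> (x i)\<bar>"]) (auto intro: sum_nonneg)
    finally show ?thesis by (simp add: M_def)
  qed
  have "M > 0" unfolding M_def by (intro add_pos_nonneg sum_nonneg) auto
  \<comment> \<open>Each of the \<open>m\<close> weights will be off by at most
    \<open>4 * m * \<eta>\<close> and is multiplied by a value of size at most \<open>M\<close>.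
    Taking \<open>\<eta>\<close> of the form \<open>1 / N\<close> makes it rational.\<close>
  have "\<epsilon> / (4 * real m * real m * M) > 0" using \<open>\<epsilon> > 0\<close> \<open>M > 0\<close> \<open>m > 0\<close> by simp
  then obtain N where N: "N > 0" "inverse (real N) < \<epsilon> / (4 * real m * real m * M)"
    using real_arch_inverse by (metis gr0I)
  define \<eta> where "\<eta> = 1 / real N"
  have \<eta>: "\<eta> > 0" "\<eta> \<in> \<rat>" "4 * real m * real m * M * \<eta> < \<epsilon>"
    using N \<open>M > 0\<close> \<open>m > 0\<close> by (auto simp: \<eta>_def field_simps)
  \<comment> \<open>The shift by \<open>\<eta>\<close> keeps the denominator positive on the whole cube, so that \<open>r\<close> maps the cube
    continuously into the standard simplex, sends rational points to rational points, and almost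
    fixes the points near the simplex.\<close>
  define r where "r i t = (t i + \<eta>) / ((\<Sum>j<m. t j) + real m * \<eta>)" for i and t :: "nat \<Rightarrow> real"
  define X where "X t = (\<Sum>i<m. r i t *\<^sub>R x i)" for t
  define Q where "Q = PiE UNIV (\<lambda>_::nat. {0..1::real})"
  have denom: "(\<Sum>j<m. t j) + real m * \<eta> > 0" if "t \<in> Q" for t
    using that \<open>m > 0\<close> \<eta>(1) by (intro add_nonneg_pos sum_nonneg) (auto simp: Q_def PiE_iff)
  have r0: "0 \<le> r i t" if "t \<in> Q" for i t
    using that denom[OF that] \<eta>(1) by (auto simp: r_def Q_def PiE_iff intro!: divide_nonneg_pos add_nonneg_pos)
  have rsum: "(\<Sum>i<m. r i t) = 1" if "t \<in> Q" for t
    using denom[OF that] by (simp add: r_def sum.distrib flip: sum_divide_distrib)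
  have XC: "X t \<in> C" if "t \<in> Q" for t
    unfolding X_def using r0[OF that] rsum[OF that] xC by (intro convex_sum C) auto
  have XA: "X t \<in> A" if "t \<in> Q" "\<And>i. t i \<in> \<rat>" for t
    unfolding X_def using r0[OF that(1)] rsum[OF that(1)] xA \<eta>(2) that(2)
    by (intro rationally_convex_sum A(4)) (auto simp: r_def intro!: Rats_divide Rats_add Rats_sum Rats_mult)
  have coord: "continuous_on Q (\<lambda>t. t i)" for i
    by (rule continuous_on_subset[OF continuous_on_product_coordinates]) simp
  have contr: "continuous_on Q (r i)" for i
    unfolding r_def using denom by (intro continuous_intros coord) force
  have "continuous_map (top_of_set Q) \<tau> X"
    unfolding X_def using contr by (intro continuous_map_tvs_sum \<tau>) simp
  then have "continuous_map (top_of_set Q) (subtopology \<tau> C) X"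
    using XC by (simp add: continuous_map_in_subtopology image_subset_iff)
  then have "continuous_map (top_of_set Q) (subtopology \<tau> C) (f \<circ> X)"
    using f by (rule continuous_map_compose)
  then have "continuous_map (top_of_set Q) \<tau> (f \<circ> X)"
    by (rule continuous_map_into_fulltopology)
  then have contfX: "continuous_on Q (\<lambda>t. \<phi> (f (X t)))" if "\<phi> \<in> \<Phi>" for \<phi>
    using continuous_map_compose[OF _ cont\<phi>[OF that]] by (fastforce simp: o_def)
  \<comment> \<open>The product vanishes as soon as one functional in \<open>\<Phi>\<close>
    separates \<open>f (X t)\<close> from \<open>x i\<close> by \<open>2 * \<epsilon>\<close>. If
    all of them are within \<open>\<epsilon>\<close>, every factor is at least
    \<open>\<epsilon>\<close>, so the product is at least \<open>\<delta>\<close>.\<close>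
  define u where "u i t = (\<Prod>\<phi>\<in>\<Phi>. max 0 (2 * \<epsilon> - \<bar>\<phi> (f (X t)) - \<phi> (x i)\<bar>))" for i t
  define \<delta> where "\<delta> = \<epsilon> ^ card \<Phi>"
  \<comment> \<open>The sum may drop below \<open>\<delta>\<close>, and even vanish, where \<open>X t\<close> is outside \<open>A\<close>; it is at least \<open>\<delta>\<close> at
    rational points, where \<open>g t\<close> is therefore a genuine vector of convex weights.\<close>
  define g where "g t i = u i t / max \<delta> (\<Sum>j<m. u j t)" for t i
  have "\<delta> > 0" using \<open>\<epsilon> > 0\<close> by (simp add: \<delta>_def)
  have u0: "0 \<le> u i t" for i t unfolding u_def by (intro prod_nonneg) auto
  have contu: "continuous_on Q (u i)" for i
    unfolding u_def by (intro continuous_intros contfX)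
  have contg: "continuous_on Q (\<lambda>t. g t i)" for i
    unfolding g_def using \<open>\<delta> > 0\<close> by (intro continuous_intros contu) (auto simp: max_def)
  have g0: "0 \<le> g t i" for t i
    unfolding g_def using \<open>\<delta> > 0\<close> u0 by (intro divide_nonneg_pos) auto
  have g1: "g t i \<le> 1" if "i < m" for t i
  proof -
    have "u i t \<le> (\<Sum>j<m. u j t)" using u0 that by (intro member_le_sum[where f = "\<lambda>j. u j t"]) auto
    then show ?thesis unfolding g_def using \<open>\<delta> > 0\<close> by (simp add: divide_le_eq_1 max_def)
  qed
  obtain t where t: "t \<in> Q" "\<And>i. t i \<in> \<rat>" "\<And>i. i < m \<Longrightarrow> \<bar>g t i - t i\<bar> < \<eta>"
    using approximate_brouwer_rational[of m g \<eta>, folded Q_def] contg g0 g1 \<eta>(1) by blast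
  define a where "a = X t"
  have aA: "a \<in> A" "f a \<in> A" using XA[OF t(1,2)] A(3) by (auto simp: a_def)
  obtain k where k: "k < m" "\<And>\<phi>. \<phi> \<in> \<Phi> \<Longrightarrow> \<bar>\<phi> (f a) - \<phi> (x k)\<bar> < \<epsilon>"
    using F(3)[OF aA(2)] x by blast
  have "\<delta> = (\<Prod>\<phi>\<in>\<Phi>. \<epsilon>)" by (simp add: \<delta>_def)
  also have "\<dots> \<le> u k t"
    unfolding u_def a_def[symmetric] using k(2) \<open>\<epsilon> > 0\<close> by (intro prod_mono) (force simp: le_max_iff_disj)
  also have "\<dots> \<le> (\<Sum>j<m. u j t)" using u0 k(1) by (intro member_le_sum[where f = "\<lambda>j. u j t"]) auto
  finally have ge: "\<delta> \<le> (\<Sum>j<m. u j t)" .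
  then have gsum: "(\<Sum>i<m. g t i) = 1"
    using \<open>\<delta> > 0\<close> by (simp add: g_def max_def flip: sum_divide_distrib)
  have gnear: "g t i * \<bar>\<phi> (x i) - \<phi> (f a)\<bar> \<le> g t i * (2 * \<epsilon>)" if "\<phi> \<in> \<Phi>" for i \<phi>
  proof (cases "g t i = 0")
    case False
    then have "u i t \<noteq> 0" by (auto simp: g_def)
    then have "max 0 (2 * \<epsilon> - \<bar>\<phi> (f a) - \<phi> (x i)\<bar>) \<noteq> 0"
      using that \<Phi>(1) by (simp add: u_def a_def)
    then have "\<bar>\<phi> (x i) - \<phi> (f a)\<bar> \<le> 2 * \<epsilon>" by (simp add: max_def abs_minus_commute split: if_splits)
    then show ?thesis using g0 by (intro mult_left_mono) auto
  qed simp
  have rg: "\<bar>r i t - g t i\<bar> \<le> 4 * real m * \<eta>" if "i < m" for i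
  proof -
    define D where "D = (\<Sum>j<m. t j) + real m * \<eta>"
    have "\<bar>(\<Sum>j<m. g t j) - (\<Sum>j<m. t j)\<bar> \<le> (\<Sum>j<m. \<bar>g t j - t j\<bar>)"
      by (simp flip: sum_subtractf)
    also have "\<dots> \<le> (\<Sum>j<m. \<eta>)" using t(3) by (intro sum_mono) (auto intro: less_imp_le)
    finally have "\<bar>1 - (\<Sum>j<m. t j)\<bar> \<le> real m * \<eta>" by (simp add: gsum)
    \<comment> \<open>The shift \<open>real m * \<eta>\<close> compensates the largest possible
      deficit of the sum of the \<open>t j\<close>, so \<open>D\<close> is at least 1 and dividing
      by it does not enlarge nonnegative numbers.\<close>
    then have D: "1 \<le> D" "D - 1 \<le> 2 * (real m * \<eta>)" unfolding D_def by linarith+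
    have ti: "0 \<le> t i" "t i \<le> 1" using t(1) by (auto simp: Q_def PiE_iff)
    have le1: "z / D \<le> z" if "0 \<le> z" for z
      using that D(1) by (simp add: divide_le_eq mult_le_cancel_left1)
    have "r i t - t i = \<eta> / D - t i * (D - 1) / D"
      using D(1) by (simp add: r_def flip: D_def) (simp add: field_simps)
    moreover have "\<eta> / D \<le> \<eta>" "0 \<le> \<eta> / D" using le1[of \<eta>] \<eta>(1) D(1) by auto
    moreover have "t i * (D - 1) / D \<le> 2 * (real m * \<eta>)" "0 \<le> t i * (D - 1) / D"
    proof -
      have "t i * (D - 1) / D \<le> t i * (D - 1)" using ti D(1) by (intro le1) auto
      also have "\<dots> \<le> D - 1" using ti D(1) by (simp add: mult_left_le_one_le)
      finally show "t i * (D - 1) / D \<le> 2 * (real m * \<eta>)" using D(2) by simp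
      show "0 \<le> t i * (D - 1) / D" using ti D(1) by simp
    qed
    ultimately have "\<bar>r i t - t i\<bar> \<le> \<eta> + 2 * (real m * \<eta>)" by linarith
    moreover have "\<eta> \<le> real m * \<eta>" using \<open>m > 0\<close> \<eta>(1) by simp
    ultimately show ?thesis using t(3)[OF that] by linarith
  qed
  have "\<bar>\<phi> (a - f a)\<bar> < e" if "\<phi> \<in> \<Phi>" for \<phi>
  proof -
    have "\<phi> (a - f a) = \<phi> a - \<phi> (f a)" using lin[OF that] by (rule linear_diff)
    also have "\<phi> a = (\<Sum>i<m. r i t * \<phi> (x i))"
      by (simp add: a_def X_def linear_sum[OF lin[OF that]] linear_cmul[OF lin[OF that]])
    also have "\<phi> (f a) = (\<Sum>i<m. g t i * \<phi> (f a))" by (simp add: gsum flip: sum_distrib_right)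
    \<comment> \<open>The first term measures the error in the weights, the second the distance from
      \<open>f a\<close> of the net points that carry weight.\<close>
    also have "(\<Sum>i<m. r i t * \<phi> (x i)) - (\<Sum>i<m. g t i * \<phi> (f a)) =
        (\<Sum>i<m. (r i t - g t i) * \<phi> (x i) + g t i * (\<phi> (x i) - \<phi> (f a)))"
      by (simp add: algebra_simps flip: sum_subtractf)
    also have "\<bar>\<dots>\<bar> \<le> (\<Sum>i<m. 4 * real m * \<eta> * M + g t i * (2 * \<epsilon>))"
    proof (rule order_trans[OF sum_abs], rule sum_mono)
      fix i assume "i \<in> {..<m}"
      then have "i < m" by simp
      have "\<bar>(r i t - g t i) * \<phi> (x i)\<bar> \<le> 4 * real m * \<eta> * M"
        unfolding abs_mult using rg[OF \<open>i < m\<close>] M[OF that \<open>i < m\<close>] \<eta>(1) by (intro mult_mono) auto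
      moreover have "\<bar>g t i * (\<phi> (x i) - \<phi> (f a))\<bar> \<le> g t i * (2 * \<epsilon>)"
        using gnear[OF that, of i] g0[of t i] by (simp add: abs_mult)
      ultimately show "\<bar>(r i t - g t i) * \<phi> (x i) + g t i * (\<phi> (x i) - \<phi> (f a))\<bar>
          \<le> 4 * real m * \<eta> * M + g t i * (2 * \<epsilon>)" by linarith
    qed
    also have "\<dots> = 4 * real m * real m * M * \<eta> + 2 * \<epsilon>"
      by (simp add: sum.distrib gsum flip: sum_distrib_right)
    also have "\<dots> < e" using \<eta>(3) \<open>\<epsilon> > 0\<close> by (simp add: \<epsilon>_def)
    finally show ?thesis .
  qed
  then show ?thesis using aA(1) by blast
qed

section \<open>Norming functionals and uniform boundedness\<close>

definition sublinear :: "('a::real_vector \<Rightarrow> real) \<Rightarrow> bool" where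
  "sublinear p \<longleftrightarrow> (\<forall>x y. p (x + y) \<le> p x + p y) \<and> (\<forall>c x. 0 \<le> c \<longrightarrow> p (c *\<^sub>R x) = c * p x)"

text \<open>This keeps the pointwise infimum of a chain finite and gives one half of the oddness of
  minimal functions.\<close>

lemma sublinear_lower:
  assumes "sublinear p"
  shows "- p (- x) \<le> p x"
proof -
  have "p (x + - x) \<le> p x + p (- x)" using assms unfolding sublinear_def by blast
  moreover have "p 0 = 0" using assms unfolding sublinear_def by (metis mult_zero_left order_refl scaleR_zero_left)
  ultimately show ?thesis by simp
qed

text \<open>Since a minimal sublinear \<open>p\<close> cannot be lowered in this way, it satisfies \<open>p (- x) = - p x\<close>. Applied to
  the norm, the same construction produces a sublinear function all of whose linear minorants norm \<open>x\<close>.\<close>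

lemma sublinear_tilt:
  assumes p: "sublinear p"
  shows "\<exists>q. sublinear q \<and> q \<le> p \<and> q (- x) \<le> - p x"
proof -
  have add: "p (y + z) \<le> p y + p z" and scale: "0 \<le> c \<Longrightarrow> p (c *\<^sub>R y) = c * p y" for y z c
    using p by (auto simp: sublinear_def)
  have p0: "p 0 = 0" using scale[of 0 0] by simp
  \<comment> \<open>The parameter \<open>t = 0\<close> gives \<open>q \<le> p\<close>, and
    \<open>t = 1\<close> gives the new bound at \<open>- x\<close>.\<close>
  define q where "q y = (INF t\<in>{0..}. p (y + t *\<^sub>R x) - t * p x)" for y
  have "- p (- y) \<le> p (y + t *\<^sub>R x) - t * p x" if "t \<ge> 0" for t y
    using add[of "y + t *\<^sub>R x" "- y"] scale[OF that, of x] by simp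
  then have bdd: "bdd_below ((\<lambda>t. p (y + t *\<^sub>R x) - t * p x) ` {0..})" for y
    by (intro bdd_belowI2[of _ "- p (- y)"]) auto
  have le: "q y \<le> p (y + t *\<^sub>R x) - t * p x" if "t \<ge> 0" for t y
    unfolding q_def using bdd that by (intro cINF_lower) auto
  have ge: "b \<le> q y" if "\<And>t. t \<ge> 0 \<Longrightarrow> b \<le> p (y + t *\<^sub>R x) - t * p x" for b y
    unfolding q_def using that by (intro cINF_greatest) auto
  have qadd: "q (y + z) \<le> q y + q z" for y z
  proof -
    have "q (y + z) - (p (z + t *\<^sub>R x) - t * p x) \<le> q y" if "t \<ge> 0" for t
    proof (rule ge)
      fix s :: real assume "s \<ge> 0"
      then have "q (y + z) \<le> p ((y + z) + (s + t) *\<^sub>R x) - (s + t) * p x"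
        using that by (intro le) auto
      also have "(y + z) + (s + t) *\<^sub>R x = (y + s *\<^sub>R x) + (z + t *\<^sub>R x)"
        by (simp add: algebra_simps)
      also have "p \<dots> \<le> p (y + s *\<^sub>R x) + p (z + t *\<^sub>R x)" by (rule add)
      finally show "q (y + z) - (p (z + t *\<^sub>R x) - t * p x) \<le> p (y + s *\<^sub>R x) - s * p x"
        by (simp add: algebra_simps)
    qed
    then have "q (y + z) - q y \<le> q z"
      by (intro ge) (smt (verit))
    then show ?thesis by simp
  qed
  \<comment> \<open>Substituting \<open>t / c\<close> for the parameter gives this inequality; the
    reverse one is the same statement for \<open>1 / c\<close>.\<close>
  have qscale_le: "c * q y \<le> q (c *\<^sub>R y)" if "c > 0" for c y
  proof (rule ge)
    fix t :: real assume "t \<ge> 0"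
    then have "q y \<le> p (y + (t / c) *\<^sub>R x) - t / c * p x" using that by (intro le) auto
    then have "c * q y \<le> c * p (y + (t / c) *\<^sub>R x) - t * p x"
      using that by (simp add: field_simps)
    also have "c * p (y + (t / c) *\<^sub>R x) = p (c *\<^sub>R y + t *\<^sub>R x)"
      using that scale[of c "y + (t / c) *\<^sub>R x"] by (simp add: scaleR_add_right)
    finally show "c * q y \<le> p (c *\<^sub>R y + t *\<^sub>R x) - t * p x" .
  qed
  have qscale: "q (c *\<^sub>R y) = c * q y" if "c \<ge> 0" for c y
  proof (cases "c = 0")
    case True
    have "0 \<le> q 0" using scale[of _ x] by (intro ge) auto
    moreover have "q 0 \<le> 0" using le[of 0 0] p0 by simp
    ultimately show ?thesis using True by simp
  next
    case False
    then have "c > 0" using that by simp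
    then have "q (c *\<^sub>R y) \<le> c * q y"
      using qscale_le[of "1 / c" "c *\<^sub>R y"] by (simp add: field_simps)
    then show ?thesis using qscale_le[OF \<open>c > 0\<close>, of y] by simp
  qed
  have "sublinear q" using qadd qscale by (auto simp: sublinear_def)
  moreover have "q \<le> p" using le[of 0] by (auto simp: le_fun_def)
  moreover have "q (- x) \<le> - p x" using le[of 1 "- x"] p0 by simp
  ultimately show ?thesis by blast
qed

text \<open>Tilting cannot lower a minimal \<open>p\<close>, so \<open>p\<close> is odd; an odd
  subadditive function is additive because \<open>p x \<le> p (x + y) + p (- y)\<close>.\<close>

lemma minimal_sublinear_linear:
  assumes p: "sublinear p" and minimal: "\<And>q. sublinear q \<Longrightarrow> q \<le> p \<Longrightarrow> q = p"
  shows "linear p"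
proof -
  have add: "p (y + z) \<le> p y + p z" and scale: "0 \<le> c \<Longrightarrow> p (c *\<^sub>R y) = c * p y" for y z c
    using p by (auto simp: sublinear_def)
  have odd: "p (- x) = - p x" for x
  proof -
    obtain q where "sublinear q" "q \<le> p" "q (- x) \<le> - p x" using sublinear_tilt[OF p] by blast
    then have "p (- x) \<le> - p x" using minimal by metis
    then show ?thesis using sublinear_lower[OF p, of x] by simp
  qed
  have "p (x + y) = p x + p y" for x y
    using add[of x y] add[of "x + y" "- y"] odd[of y] by simp
  moreover have "p (c *\<^sub>R x) = c * p x" for c x
    using scale[of c x] scale[of "- c" x] odd[of "c *\<^sub>R x"] by (cases "0 \<le> c") auto
  ultimately show ?thesis by (intro linearI) auto
qed

text \<open>A form of the Hahn-Banach theorem: Zorn's lemma for the reversed order yields a minimal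
  sublinear function below \<open>p\<close>, and lower bounds of chains are pointwise
  infima.\<close>

lemma exists_linear_below_sublinear:
  fixes p :: "'a::real_vector \<Rightarrow> real"
  assumes p: "sublinear p"
  shows "\<exists>f. linear f \<and> f \<le> p"
proof -
  define S where "S = {q. sublinear q \<and> q \<le> p}"
  have "\<exists>m\<in>S. \<forall>a\<in>S. a \<le> m \<longrightarrow> a = m"
  proof (rule predicate_Zorn[where P = "\<lambda>a b. b \<le> a"])
    show "partial_order_on S (relation_of (\<lambda>a b. b \<le> a) S)"
      by (rule partial_order_on_relation_ofI) auto
    fix C assume "C \<in> Chains (relation_of (\<lambda>a b. b \<le> a) S)"
    then have CS: "C \<subseteq> S" and chain: "\<And>a b. a \<in> C \<Longrightarrow> b \<in> C \<Longrightarrow> a \<le> b \<or> b \<le> a"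
      by (auto simp: Chains_def relation_of_def)
    show "\<exists>u\<in>S. \<forall>a\<in>C. u \<le> a"
    proof (cases "C = {}")
      case True
      then show ?thesis using p by (auto simp: S_def)
    next
      case False
      define u where "u x = (INF q\<in>C. q x)" for x
      have "- p (- x) \<le> q x" if "q \<in> C" for q x
      proof -
        have "sublinear q" "q (- x) \<le> p (- x)" using that CS by (auto simp: S_def le_fun_def)
        then show ?thesis using sublinear_lower[of q x] by simp
      qed
      then have bdd: "bdd_below ((\<lambda>q. q x) ` C)" for x
        by (intro bdd_belowI2[of _ "- p (- x)"]) auto
      have le: "u x \<le> q x" if "q \<in> C" for x q
        unfolding u_def using bdd that by (intro cINF_lower) auto
      have ge: "b \<le> u x" if "\<And>q. q \<in> C \<Longrightarrow> b \<le> q x" for b x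
        unfolding u_def using that False by (intro cINF_greatest) auto
      have "u (x + y) - q2 y \<le> q1 x" if "q1 \<in> C" "q2 \<in> C" for q1 q2 x y
      proof -
        \<comment> \<open>Infima of sublinear functions are not subadditive in general; here the
          smaller of the two chain members serves both arguments.\<close>
        obtain q where q: "q \<in> C" "q \<le> q1" "q \<le> q2" using chain \<open>q1 \<in> C\<close> \<open>q2 \<in> C\<close> by blast
        have "u (x + y) \<le> q (x + y)" using le q by blast
        also have "\<dots> \<le> q x + q y" using q(1) CS by (auto simp: S_def sublinear_def)
        also have "\<dots> \<le> q1 x + q2 y" using q by (intro add_mono) (auto simp: le_fun_def)
        finally show ?thesis by simp
      qed
      then have "u (x + y) - q2 y \<le> u x" if "q2 \<in> C" for q2 x y
        using that by (intro ge) auto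
      then have "u (x + y) - u x \<le> u y" for x y
        by (intro ge) (smt (verit))
      then have add: "u (x + y) \<le> u x + u y" for x y
        by (smt (verit))
      have "u (c *\<^sub>R x) = c * u x" if "c \<ge> 0" for c x
      proof (cases "c = 0")
        case True
        have "q 0 = 0" if "q \<in> C" for q
        proof -
          have "sublinear q" using that CS by (auto simp: S_def)
          then show ?thesis unfolding sublinear_def by (metis mult_zero_left order_refl scaleR_zero_left)
        qed
        then have "(\<lambda>q. q 0) ` C = {0}" using \<open>C \<noteq> {}\<close> by (force simp: image_iff)
        then have "u 0 = 0" by (simp add: u_def)
        then show ?thesis using True by simp
      next
        case False
        then have c: "c > 0" using that by simp
        have sc: "q (c *\<^sub>R x) = c * q x" if "q \<in> C" for q
          using that CS \<open>c \<ge> 0\<close> by (auto simp: S_def sublinear_def)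
        have "c * u x \<le> u (c *\<^sub>R x)"
        proof (rule ge)
          fix q assume "q \<in> C"
          then show "c * u x \<le> q (c *\<^sub>R x)" using le[of q x] sc[of q] c by simp
        qed
        moreover have "u (c *\<^sub>R x) / c \<le> u x"
        proof (rule ge)
          fix q assume "q \<in> C"
          then show "u (c *\<^sub>R x) / c \<le> q x"
            using le[of q "c *\<^sub>R x"] sc c by (simp add: field_simps)
        qed
        ultimately show ?thesis using c by (simp add: field_simps)
      qed
      then have "sublinear u" using add by (auto simp: sublinear_def)
      moreover have "u \<le> p"
      proof -
        obtain q where "q \<in> C" using False by blast
        then have "u \<le> q" "q \<le> p" using le CS by (auto simp: S_def le_fun_def)
        then show ?thesis by (rule order_trans)
      qed
      ultimately show ?thesis using le by (auto simp: S_def le_fun_def)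
    qed
  qed
  then obtain m where m: "sublinear m" "m \<le> p" "\<And>a. sublinear a \<Longrightarrow> a \<le> p \<Longrightarrow> a \<le> m \<Longrightarrow> a = m"
    by (auto simp: S_def)
  then have "linear m"
    by (intro minimal_sublinear_linear) (use order_trans in blast)+
  with m(2) show ?thesis by blast
qed

text \<open>Tilting the norm at \<open>x\<close> yields \<open>q\<close> with
  \<open>q (- x) \<le> - norm x\<close>, so every linear \<open>f\<close> below \<open>q\<close>
  satisfies \<open>norm x \<le> f x\<close>.\<close>

lemma exists_norming_functional:
  fixes x :: "'a::real_normed_vector"
  obtains \<phi> :: "'a \<Rightarrow>\<^sub>L real" where "norm \<phi> \<le> 1" "norm x \<le> \<phi> x"
proof -
  have "sublinear (norm :: 'a \<Rightarrow> real)" by (auto simp: sublinear_def norm_triangle_ineq)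
  then obtain q where q: "sublinear q" "q \<le> norm" "q (- x) \<le> - norm x"
    using sublinear_tilt by blast
  then obtain f where f: "linear f" "f \<le> q" using exists_linear_below_sublinear by blast
  have fle: "f y \<le> norm y" for y using f(2) q(2) by (meson le_funD order_trans)
  have fneg: "f (- y) = - f y" for y using f(1) by (rule linear_neg)
  have bd: "\<bar>f y\<bar> \<le> norm y" for y
    using fle[of y] fle[of "- y"] fneg[of y] by (simp add: abs_le_iff)
  have bl: "bounded_linear f"
    using f(1) bd by (auto simp: bounded_linear_def bounded_linear_axioms_def intro!: exI[of _ 1])
  show thesis
  proof
    show "norm (Blinfun f) \<le> 1"
      by (rule norm_blinfun_bound) (use bd in \<open>auto simp: bounded_linear_Blinfun_apply[OF bl]\<close>)
    have "f (- x) \<le> - norm x" using f(2) q(3) by (meson le_funD order_trans)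
    then show "norm x \<le> Blinfun f x"
      by (simp add: bounded_linear_Blinfun_apply[OF bl] fneg)
  qed
qed

text \<open>The Baire argument runs in the dual, which is complete even if the space is not; norming
  functionals carry the bound back.\<close>

lemma weakly_bounded_imp_bounded:
  fixes C :: "'a::real_normed_vector set"
  assumes "\<And>\<phi> :: 'a \<Rightarrow>\<^sub>L real. bounded (blinfun_apply \<phi> ` C)"
  shows "bounded C"
proof -
  define F where "F k = {\<phi> :: 'a \<Rightarrow>\<^sub>L real. \<forall>x\<in>C. \<bar>\<phi> x\<bar> \<le> real k}" for k :: nat
  have closed: "closed (F k)" for k
  proof -
    have "F k = (\<Inter>x\<in>C. {\<phi>. \<bar>blinfun_apply \<phi> x\<bar> \<le> real k})" by (auto simp: F_def)
    also have "closed \<dots>"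
      by (intro closed_INT ballI closed_Collect_le continuous_intros)
    finally show ?thesis .
  qed
  have "\<phi> \<in> (\<Union>k. F k)" for \<phi>
  proof -
    obtain B where "\<And>x. x \<in> C \<Longrightarrow> \<bar>\<phi> x\<bar> \<le> B" using assms[of \<phi>] by (auto simp: bounded_iff)
    moreover obtain k where "B \<le> real k" using real_arch_simple by blast
    ultimately have "\<phi> \<in> F k" unfolding F_def by (auto intro: order_trans)
    then show ?thesis by blast
  qed
  then have "(\<Union>k. F k) = UNIV" by blast
  then obtain k where "interior (F k) \<noteq> {}"
    using Baire_category_alt[of "euclidean :: ('a \<Rightarrow>\<^sub>L real) topology" "range F"] closed
    by (force simp: completely_metrizable_space_euclidean)
  then obtain \<phi>0 r where r: "r > 0" "ball \<phi>0 r \<subseteq> F k"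
    by (auto simp: mem_interior)
  have "norm x \<le> 4 * real k / r" if "x \<in> C" for x
  proof -
    obtain \<phi> where \<phi>: "norm \<phi> \<le> 1" "norm x \<le> blinfun_apply \<phi> x"
      using exists_norming_functional .
    \<comment> \<open>Half the radius keeps \<open>\<phi>0 + \<psi>\<close> inside the ball. Two
      values bounded by \<open>k\<close> differ by at most \<open>2 * k\<close>, whence the constant
      \<open>4 * k / r\<close>.\<close>
    define \<psi> where "\<psi> = (r / 2) *\<^sub>R \<phi>"
    have "norm \<psi> < r" using \<phi>(1) r(1) mult_left_mono[OF \<phi>(1), of "r/2"] by (simp add: \<psi>_def)
    then have "\<phi>0 + \<psi> \<in> F k" "\<phi>0 \<in> F k" using r by (auto simp: dist_norm)
    then have "\<bar>\<phi>0 x + \<psi> x\<bar> \<le> real k" "\<bar>\<phi>0 x\<bar> \<le> real k" using that by (auto simp: F_def blinfun.add_left)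
    then have "\<psi> x \<le> 2 * real k" by simp
    then have "r / 2 * \<phi> x \<le> 2 * real k" by (simp add: \<psi>_def blinfun.scaleR_left)
    then have "\<phi> x \<le> 4 * real k / r" using r(1) by (simp add: field_simps)
    then show ?thesis using \<phi>(2) by simp
  qed
  then show ?thesis by (auto simp: bounded_iff)
qed

section \<open>Weak* compactness\<close>

text \<open>If convergence fails at \<open>x\<close>, the finite intersection property gives a
  functional in \<open>K\<close> that vanishes on all \<open>y k\<close> but not at
  \<open>x\<close>.\<close>

lemma tendsto_zero_weak_star_compact:
  fixes d :: "nat \<Rightarrow> 'a::real_normed_vector \<Rightarrow>\<^sub>L real"
  assumes "compactin weak_star_topology K" "\<And>n. d n \<in> K"
    and sep: "\<And>\<phi>. \<phi> \<in> K \<Longrightarrow> (\<And>k. blinfun_apply \<phi> (y k) = 0) \<Longrightarrow> \<phi> = 0"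
    and small: "\<And>n k. k \<le> n \<Longrightarrow> \<bar>d n (y k)\<bar> < 1 / real (Suc n)"
  shows "(\<lambda>n. d n x) \<longlonglongrightarrow> 0"
proof (rule ccontr)
  assume "\<not> ?thesis"
  then obtain e where e: "e > 0" "\<And>m. \<exists>n\<ge>m. \<bar>d n x\<bar> \<ge> e"
    unfolding LIMSEQ_def by (auto simp: dist_real_def not_less)
  \<comment> \<open>The inequalities are not strict, so that \<open>F m\<close> is closed; a larger
    \<open>m\<close> adds conditions and sharpens the old ones, so the sets decrease.\<close>
  define F where "F m = {\<phi>::'a \<Rightarrow>\<^sub>L real. \<bar>\<phi> x\<bar> \<ge> e \<and> (\<forall>k\<le>m. \<bar>\<phi> (y k)\<bar> \<le> 1 / real (Suc m))}" for m
  have closed: "closedin weak_star_topology (F m)" for m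
  proof -
    have ev: "continuous_map weak_star_topology euclideanreal (\<lambda>\<phi>::'a \<Rightarrow>\<^sub>L real. \<bar>\<phi> z\<bar>)" for z
      by (intro continuous_map_real_abs strong_operator_topology_continuous_evaluation)
    have 1: "closedin weak_star_topology {\<phi>::'a \<Rightarrow>\<^sub>L real. \<phi> \<in> topspace weak_star_topology \<and> \<bar>\<phi> x\<bar> \<in> {e..}}"
      by (rule closedin_continuous_map_preimage[OF ev]) auto
    have 2: "closedin weak_star_topology {\<phi>::'a \<Rightarrow>\<^sub>L real. \<phi> \<in> topspace weak_star_topology \<and> \<bar>\<phi> (y k)\<bar> \<in> {..1 / real (Suc m)}}" for k
      by (rule closedin_continuous_map_preimage[OF ev]) auto
    have "F m = {\<phi>::'a \<Rightarrow>\<^sub>L real. \<phi> \<in> topspace weak_star_topology \<and> \<bar>\<phi> x\<bar> \<in> {e..}} \<inter>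
       (\<Inter>k\<in>{..m}. {\<phi>::'a \<Rightarrow>\<^sub>L real. \<phi> \<in> topspace weak_star_topology \<and> \<bar>\<phi> (y k)\<bar> \<in> {..1 / real (Suc m)}})"
      by (auto simp: F_def strong_operator_topology_topspace)
    then show ?thesis using 1 2 by (auto intro!: closedin_Int closedin_Inter)
  qed
  have mono: "F n \<subseteq> F m" if "m \<le> n" for m n
  proof -
    have "1 / real (Suc n) \<le> 1 / real (Suc m)" using that by (intro divide_left_mono) auto
    then show ?thesis using that by (auto simp: F_def intro: order_trans)
  qed
  have ne: "K \<inter> F m \<noteq> {}" for m
  proof -
    obtain n where n: "n \<ge> m" "\<bar>d n x\<bar> \<ge> e" using e(2) by blast
    then have "d n \<in> F n" using small[of _ n] by (auto simp: F_def intro: less_imp_le)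
    then show ?thesis using mono[OF n(1)] assms(2) by blast
  qed
  have "K \<inter> \<Inter>(range F) \<noteq> {}"
  proof -
    have "K \<inter> \<Inter>\<F> \<noteq> {}" if fin: "finite \<F>" "\<F> \<subseteq> range F" for \<F>
    proof -
      obtain I where I: "finite I" "\<F> = F ` I" using finite_subset_image[OF fin] by blast
      have "F (Max (insert 0 I)) \<subseteq> F i" if "i \<in> I" for i
        using that I(1) by (intro mono) simp
      then have "F (Max (insert 0 I)) \<subseteq> \<Inter>\<F>" using I(2) by blast
      then show ?thesis using ne[of "Max (insert 0 I)"] by blast
    qed
    then show ?thesis
      using closed assms(1)[unfolded compactin_fip, THEN conjunct2, THEN spec[of _ "range F"]] by simp
  qed
  then obtain \<phi> where \<phi>: "\<phi> \<in> K" "\<And>m. \<phi> \<in> F m" by blast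
  have "\<phi> (y k) = 0" for k
  proof -
    have *: "\<bar>\<phi> (y k)\<bar> \<le> 1 / real (Suc m)" if "k \<le> m" for m
      using \<phi>(2)[of m] that by (simp add: F_def)
    have "(\<lambda>m. 1 / real (Suc m)) \<longlonglongrightarrow> 0" by (rule LIMSEQ_Suc[OF lim_1_over_n])
    then have "\<bar>\<phi> (y k)\<bar> \<le> 0"
      using * by (intro tendsto_lowerbound[where F = sequentially]) (auto simp: eventually_at_top_linorder)
    then show ?thesis by simp
  qed
  then have "\<phi> = 0" using sep \<phi>(1) by blast
  then show False using \<phi>(2)[of 0] e(1) by (simp add: F_def)
qed

text \<open>Banach-Alaoglu: the linear functions in a product of compact intervals form a compact
  set, \<open>Blinfun\<close> carries it continuously to the dual, and \<open>K\<close> is a closed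
  subset of the image.\<close>

lemma weak_star_compact:
  fixes K :: "('a::real_normed_vector \<Rightarrow>\<^sub>L real) set"
  assumes closed: "closedin weak_star_topology K" and "bounded K"
  shows "compactin weak_star_topology K"
proof -
  obtain B where B: "B > 0" "\<And>\<phi>. \<phi> \<in> K \<Longrightarrow> norm \<phi> \<le> B" using \<open>bounded K\<close> by (meson bounded_pos)
  define P :: "('a \<Rightarrow> real) set" where "P = PiE UNIV (\<lambda>x. {- B * norm x..B * norm x})"
  define L where "L = {f \<in> P. (\<forall>x y. f (x + y) = f x + f y) \<and> (\<forall>c x. f (c *\<^sub>R x) = c * f x)}"
  have "compactin euclidean P"
    unfolding P_def euclidean_product_topology[symmetric] by (auto simp: compactin_PiE)
  then have "compact P" by simp
  moreover have "closed ((\<Inter>x. \<Inter>y. {f::'a \<Rightarrow> real. f (x + y) = f x + f y}) \<inter> (\<Inter>c. \<Inter>x. {f. f (c *\<^sub>R x) = c * f x}))"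
    by (intro closed_Int closed_INT ballI closed_Collect_eq continuous_intros continuous_on_product_coordinates)
  moreover have "L = P \<inter> ((\<Inter>x. \<Inter>y. {f::'a \<Rightarrow> real. f (x + y) = f x + f y}) \<inter> (\<Inter>c. \<Inter>x. {f. f (c *\<^sub>R x) = c * f x}))"
    by (auto simp: L_def)
  ultimately have "compact L" by (simp add: compact_Int_closed)
  have L: "bounded_linear f \<and> norm (Blinfun f) \<le> B" if "f \<in> L" for f
  proof -
    have *: "\<bar>f x\<bar> \<le> B * norm x" for x using that by (auto simp: L_def P_def PiE_iff abs_le_iff minus_le_iff)
    have "bounded_linear f" using that *
      by (intro bounded_linear_intro[of f B]) (auto simp: L_def mult.commute)
    moreover have "norm (Blinfun f) \<le> B"
      by (rule norm_blinfun_bound) (use B(1) * in \<open>auto simp: bounded_linear_Blinfun_apply[OF calculation]\<close>)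
    ultimately show ?thesis by blast
  qed
  \<comment> \<open>Only on \<open>L\<close> is \<open>Blinfun\<close> known to return the given
    function, so continuity is claimed there.\<close>
  have "continuous_map (top_of_set L) weak_star_topology Blinfun"
  proof (subst continuous_on_strong_operator_topo_iff_coordinatewise, intro allI)
    fix x
    have "continuous_map (top_of_set L) euclidean (\<lambda>f. f x)"
      by (simp add: continuous_on_subset[OF continuous_on_product_coordinates])
    then show "continuous_map (top_of_set L) euclidean (\<lambda>f. blinfun_apply (Blinfun f) x)"
      by (rule continuous_map_eq) (use L in \<open>auto simp: bounded_linear_Blinfun_apply\<close>)
  qed
  moreover have "compactin (top_of_set L) L"
    using \<open>compact L\<close> by (simp add: compactin_subtopology)
  ultimately have "compactin weak_star_topology (Blinfun ` L)"
    by (rule image_compactin[rotated])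
  moreover have "K \<subseteq> Blinfun ` L"
  proof
    fix \<phi> assume "\<phi> \<in> K"
    then have "\<bar>\<phi> x\<bar> \<le> B * norm x" for x
      using norm_blinfun[of \<phi> x] B by (smt (verit) mult_right_mono norm_ge_zero real_norm_def)
    then have "blinfun_apply \<phi> \<in> L"
      by (auto simp: L_def P_def PiE_iff abs_le_iff minus_le_iff blinfun.add_right blinfun.scaleR_right)
    then show "\<phi> \<in> Blinfun ` L" by (metis blinfun_apply_inverse image_eqI)
  qed
  ultimately show ?thesis using closed by (rule closed_compactin)
qed

text \<open>If \<open>\<phi> x \<noteq> 0\<close>, the functionals in \<open>K\<close> not vanishing
  at \<open>x\<close> form an open set, so some network member contains \<open>\<phi>\<close> and
  lies in it. The vector chosen for that member detects \<open>\<phi>\<close>.\<close>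

lemma countable_network_separating_points:
  fixes K :: "('a::real_normed_vector \<Rightarrow>\<^sub>L real) set"
  assumes "has_countable_network (subtopology weak_star_topology K)"
  obtains Y :: "nat \<Rightarrow> 'a" where "\<And>\<phi>. \<phi> \<in> K \<Longrightarrow> (\<And>k. blinfun_apply \<phi> (Y k) = 0) \<Longrightarrow> \<phi> = 0"
proof -
  obtain \<N> where \<N>: "countable \<N>"
    "\<And>U. openin (subtopology weak_star_topology K) U \<Longrightarrow> \<exists>\<M>\<subseteq>\<N>. U = \<Union>\<M>"
    using assms unfolding has_countable_network_def by metis
  define y where "y N = (SOME x. \<forall>\<phi>\<in>N. blinfun_apply \<phi> x \<noteq> 0)" for N :: "('a \<Rightarrow>\<^sub>L real) set"
  \<comment> \<open>Inserting 0 makes the enumerated set nonempty and imposes no condition on a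
    functional.\<close>
  define Y where "Y = from_nat_into (insert 0 (y ` \<N>))"
  have ran: "range Y = insert 0 (y ` \<N>)"
    unfolding Y_def using \<N>(1) by (intro range_from_nat_into) auto
  show thesis
  proof (rule that, rule ccontr)
    fix \<phi> assume \<phi>: "\<phi> \<in> K" "\<And>k. blinfun_apply \<phi> (Y k) = 0" "\<phi> \<noteq> 0"
    then obtain x where x: "\<phi> x \<noteq> 0" by (metis blinfun_eqI zero_blinfun.rep_eq)
    define U where "U = K \<inter> {\<psi>::'a \<Rightarrow>\<^sub>L real. \<psi> x \<noteq> 0}"
    have "openin weak_star_topology {\<psi>::'a \<Rightarrow>\<^sub>L real. \<forall>i\<in>{()}. \<psi> x \<in> - {0}}"
      by (rule strong_operator_topology_basis) auto
    then have "openin (subtopology weak_star_topology K) U"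
      by (auto simp: openin_subtopology U_def)
    then obtain \<M> where "\<M> \<subseteq> \<N>" "U = \<Union>\<M>" using \<N>(2) by blast
    moreover have "\<phi> \<in> U" using \<phi>(1) x by (simp add: U_def)
    ultimately obtain N where N: "N \<in> \<N>" "\<phi> \<in> N" "N \<subseteq> U" by blast
    then have "\<forall>\<psi>\<in>N. \<psi> x \<noteq> 0" by (auto simp: U_def)
    then have "\<forall>\<psi>\<in>N. \<psi> (y N) \<noteq> 0" unfolding y_def by (rule someI)
    moreover obtain k where "Y k = y N" using ran N(1) by (metis imageI insertCI rangeE)
    ultimately show False using \<phi>(2)[of k] N(2) by auto
  qed
qed

section \<open>The Asplund case\<close>

text \<open>The preimage of the interval from -1 to 1 is a neighbourhood of 0, and some multiple of
  it contains \<open>C\<close>.\<close>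

lemma bounded_image_tvs_dual:
  assumes "\<phi> \<in> tvs_dual \<tau>" "tvs \<tau>" "tvs_bounded \<tau> C"
  shows "bounded (\<phi> ` C)"
proof -
  have lin: "linear \<phi>" and cont: "continuous_map \<tau> euclideanreal \<phi>"
    using assms(1) by (auto simp: tvs_dual_def)
  define U where "U = {x \<in> topspace \<tau>. \<phi> x \<in> {-1<..<1}}"
  have "openin \<tau> U" unfolding U_def by (rule openin_continuous_map_preimage[OF cont]) auto
  moreover have "0 \<in> U" using assms(2) by (simp add: U_def tvs_def linear_0[OF lin])
  ultimately obtain s where s: "s > 0" "\<forall>t>s. C \<subseteq> (*\<^sub>R) t ` U"
    using assms(3) unfolding tvs_bounded_def by blast
  have "\<bar>\<phi> x\<bar> \<le> s + 1" if x: "x \<in> C" for x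
  proof -
    have "C \<subseteq> (*\<^sub>R) (s + 1) ` U" using s(2) by simp
    then obtain y where y: "y \<in> U" "x = (s + 1) *\<^sub>R y" using x by blast
    then have "\<bar>\<phi> x\<bar> = (s + 1) * \<bar>\<phi> y\<bar>" using s(1) by (simp add: linear_cmul[OF lin] abs_mult)
    also have "\<dots> \<le> (s + 1) * 1" using s(1) y(1) by (intro mult_left_mono) (auto simp: U_def)
    finally show ?thesis by simp
  qed
  then show ?thesis by (auto simp: bounded_iff)
qed

text \<open>Rational combinations are coded by lists, so that countability is immediate and addition
  becomes concatenation.\<close>

lemma separable_space_span:
  fixes S :: "'b::real_normed_vector set"
  assumes "countable S"
  shows "separable_space (top_of_set (span S))"
proof -
  define D where "D = (\<lambda>l. sum_list (map (\<lambda>(q, v). q *\<^sub>R v) l)) ` lists (\<rat> \<times> S)"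
  have cnt: "countable D"
    unfolding D_def using assms countable_rat by (intro countable_image countable_lists countable_SIGMA) auto
  have add: "x + y \<in> D" if "x \<in> D" "y \<in> D" for x y
  proof -
    obtain k l where "k \<in> lists (\<rat> \<times> S)" "l \<in> lists (\<rat> \<times> S)"
      "x = sum_list (map (\<lambda>(q, v). q *\<^sub>R v) k)" "y = sum_list (map (\<lambda>(q, v). q *\<^sub>R v) l)"
      using \<open>x \<in> D\<close> \<open>y \<in> D\<close> unfolding D_def by blast
    then show ?thesis unfolding D_def by (intro image_eqI[of _ _ "k @ l"]) auto
  qed
  have scale: "c *\<^sub>R x \<in> D" if "c \<in> \<rat>" "x \<in> D" for c x
  proof -
    obtain l where l: "l \<in> lists (\<rat> \<times> S)" "x = sum_list (map (\<lambda>(q, v). q *\<^sub>R v) l)"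
      using \<open>x \<in> D\<close> unfolding D_def by blast
    have "c *\<^sub>R sum_list (map (\<lambda>(q, v). q *\<^sub>R v) l) = sum_list (map (\<lambda>(q, v). q *\<^sub>R v) (map (\<lambda>(q, v). (c * q, v)) l))"
      by (induction l) (auto simp: scaleR_add_right)
    moreover have "map (\<lambda>(q, v). (c * q, v)) l \<in> lists (\<rat> \<times> S)"
      using l(1) \<open>c \<in> \<rat>\<close> by (induction l) (auto intro: Rats_mult)
    ultimately show ?thesis unfolding D_def l(2) by (metis imageI)
  qed
  have base: "S \<subseteq> D"
  proof
    fix v assume "v \<in> S"
    then show "v \<in> D" unfolding D_def by (intro image_eqI[of _ _ "[(1, v)]"]) auto
  qed
  have zero: "0 \<in> D" unfolding D_def by (intro image_eqI[of _ _ "[]"]) auto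
  have Dspan: "D \<subseteq> span S"
  proof -
    have "sum_list (map (\<lambda>(q, v). q *\<^sub>R v) l) \<in> span S" if "l \<in> lists (\<rat> \<times> S)" for l
      using that by (induction l) (auto intro: span_add span_scale span_base span_zero)
    then show ?thesis unfolding D_def by blast
  qed
  \<comment> \<open>\<open>D\<close> is closed only under rational scalars; limits supply the real
    ones, and then the closure contains the span.\<close>
  have "subspace (closure D)"
    unfolding subspace_def
  proof (intro conjI ballI allI)
    show "0 \<in> closure D" using zero closure_subset by blast
  next
    fix x y assume "x \<in> closure D" "y \<in> closure D"
    then obtain X Y where "\<And>n. X n \<in> D" "X \<longlonglongrightarrow> x" "\<And>n. Y n \<in> D" "Y \<longlonglongrightarrow> y"
      unfolding closure_sequential by blast
    then show "x + y \<in> closure D"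
      unfolding closure_sequential using add by (intro exI[of _ "\<lambda>n. X n + Y n"]) (auto intro: tendsto_add)
  next
    fix c :: real and x assume "x \<in> closure D"
    moreover have "c \<in> closure \<rat>" by (simp add: Rats_closure_real)
    ultimately obtain X Y where "\<And>n. X n \<in> D" "X \<longlonglongrightarrow> x" "\<And>n. Y n \<in> \<rat>" "Y \<longlonglongrightarrow> c"
      unfolding closure_sequential by blast
    then show "c *\<^sub>R x \<in> closure D"
      unfolding closure_sequential using scale by (intro exI[of _ "\<lambda>n. Y n *\<^sub>R X n"]) (auto intro: tendsto_scaleR)
  qed
  then have "span S \<subseteq> closure D" using base closure_subset by (intro span_minimal) auto
  then have "top_of_set (span S) closure_of D = span S"
    using Dspan by (auto simp: closure_of_subtopology Int_absorb1)
  then show ?thesis unfolding separable_space_def using cnt Dspan by (intro exI[of _ D]) auto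
qed

section \<open>The dual norm on a subspace\<close>

lemma subspace_dual_diff:
  assumes "f \<in> subspace_dual M" "g \<in> subspace_dual M"
  shows "(\<lambda>x. f x - g x) \<in> subspace_dual M"
proof -
  obtain K L where KL: "\<forall>x\<in>M. \<bar>f x\<bar> \<le> K * norm x" "\<forall>x\<in>M. \<bar>g x\<bar> \<le> L * norm x"
    using assms unfolding subspace_dual_def by blast
  have "\<bar>f x - g x\<bar> \<le> (K + L) * norm x" if "x \<in> M" for x
  proof -
    have "\<bar>f x\<bar> \<le> K * norm x" "\<bar>g x\<bar> \<le> L * norm x" using KL that by auto
    then show ?thesis unfolding distrib_right by linarith
  qed
  then have "\<exists>K. \<forall>x\<in>M. \<bar>f x - g x\<bar> \<le> K * norm x" by blast
  then show ?thesis using assms unfolding subspace_dual_def by (simp add: right_diff_distrib)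
qed

lemma subspace_dual_bound:
  assumes f: "f \<in> subspace_dual M" and M: "subspace M" and x: "x \<in> M"
  shows "\<bar>f x\<bar> \<le> subspace_dual_norm M f * norm x"
proof (cases "x = 0")
  case True
  have "f (0 *\<^sub>R x) = 0 * f x" using f x unfolding subspace_dual_def by blast
  then show ?thesis using True by simp
next
  case False
  obtain K where K: "\<forall>x\<in>M. \<bar>f x\<bar> \<le> K * norm x" using f unfolding subspace_dual_def by blast
  \<comment> \<open>\<open>K\<close> may be negative when \<open>M\<close> is trivial, hence the
    absolute value.\<close>
  have "\<bar>f y\<bar> \<le> \<bar>K\<bar>" if "y \<in> M" "norm y \<le> 1" for y
  proof -
    have "\<bar>f y\<bar> \<le> \<bar>K\<bar> * norm y"
      using K that(1) by (meson abs_ge_self mult_right_mono norm_ge_zero order_trans)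
    also have "\<dots> \<le> \<bar>K\<bar>" using that(2) by (simp add: mult_left_le)
    finally show ?thesis .
  qed
  then have bdd: "bdd_above ((\<lambda>y. \<bar>f y\<bar>) ` {y\<in>M. norm y \<le> 1})"
    by (intro bdd_aboveI2[of _ _ "\<bar>K\<bar>"]) auto
  define y where "y = (1 / norm x) *\<^sub>R x"
  have "y \<in> M" "norm y \<le> 1" using M x False by (auto simp: y_def subspace_scale)
  then have "\<bar>f y\<bar> \<le> subspace_dual_norm M f"
    unfolding subspace_dual_norm_def by (intro cSUP_upper[OF _ bdd]) auto
  moreover have "f y = (1 / norm x) * f x" using f x unfolding subspace_dual_def y_def by blast
  ultimately show ?thesis using False by (simp add: field_simps abs_mult)
qed

text \<open>The isometry \<open>J\<close> carries \<open>span A\<close> onto a separable subspace of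
  the completion, whose dual is separable. The approximating \<open>P j\<close> are defined on the
  whole space, so they can serve as functionals in the finite approximation lemma.\<close>

lemma asplund_separable_restrictions:
  fixes J :: "'a::real_normed_vector \<Rightarrow> 'b::banach"
  assumes J: "completion_embedding J" and asp: "asplund_space TYPE('b)" and "countable A"
  shows "\<exists>P :: nat \<Rightarrow> 'a \<Rightarrow> real. (\<forall>j. bounded_linear (P j)) \<and>
    (\<forall>\<phi>. bounded_linear \<phi> \<longrightarrow> (\<forall>e>0. \<exists>j. \<forall>x\<in>span A. \<bar>\<phi> x - P j x\<bar> \<le> e * norm x))"
proof -
  have lin: "linear J" and nrm: "\<And>x. norm (J x) = norm x" using J by (auto simp: completion_embedding_def)
  have inj: "inj J"
  proof (rule injI)
    fix x y assume "J x = J y"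
    then have "norm (x - y) = 0" using nrm[of "x - y"] by (simp add: linear_diff[OF lin])
    then show "x = y" by simp
  qed
  define M where "M = J ` span A"
  have M: "M = span (J ` A)" unfolding M_def by (rule linear_span_image[OF lin, symmetric])
  have subM: "subspace M" unfolding M by simp
  have "separable_space (top_of_set M)" unfolding M using \<open>countable A\<close> by (intro separable_space_span) simp
  then have "subspace_dual_separable M" using asp subM unfolding asplund_space_def by blast
  then obtain D where D: "countable D" "D \<subseteq> subspace_dual M"
    "\<And>f e. f \<in> subspace_dual M \<Longrightarrow> e > 0 \<Longrightarrow> \<exists>g\<in>D. subspace_dual_norm M (\<lambda>x. f x - g x) < e"
    unfolding subspace_dual_separable_def by blast
  define ext where "ext \<phi> y = (if y \<in> M then \<phi> (inv J y) else 0)" for \<phi> :: "'a \<Rightarrow> real" and y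
  have extJ: "ext \<phi> (J x) = \<phi> x" if "x \<in> span A" for \<phi> x
    using that by (simp add: ext_def M_def inv_f_f[OF inj])
  have ext: "ext \<phi> \<in> subspace_dual M" if bl: "bounded_linear \<phi>" for \<phi>
  proof -
    obtain K where K: "\<And>x. norm (\<phi> x) \<le> norm x * K" using bounded_linear.bounded[OF bl] by blast
    have "ext \<phi> (x + y) = ext \<phi> x + ext \<phi> y" if "x \<in> M" "y \<in> M" for x y
    proof -
      obtain x' y' where "x = J x'" "y = J y'" "x' \<in> span A" "y' \<in> span A"
        using \<open>x \<in> M\<close> \<open>y \<in> M\<close> unfolding M_def by blast
      then show ?thesis using extJ[of "x' + y'" \<phi>] extJ[of x' \<phi>] extJ[of y' \<phi>]
        by (simp add: span_add linear_add[OF lin] linear_add[OF bounded_linear.linear[OF bl]])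
    qed
    moreover have "ext \<phi> (c *\<^sub>R x) = c * ext \<phi> x" if "x \<in> M" for c x
    proof -
      obtain x' where "x = J x'" "x' \<in> span A" using \<open>x \<in> M\<close> unfolding M_def by blast
      then show ?thesis using extJ[of "c *\<^sub>R x'" \<phi>] extJ[of x' \<phi>]
        by (simp add: span_scale linear_cmul[OF lin] linear_cmul[OF bounded_linear.linear[OF bl]])
    qed
    moreover have "\<bar>ext \<phi> x\<bar> \<le> K * norm x" if "x \<in> M" for x
    proof -
      obtain x' where "x = J x'" "x' \<in> span A" using \<open>x \<in> M\<close> unfolding M_def by blast
      then show ?thesis using extJ[of x' \<phi>] K[of x'] nrm[of x'] by (simp add: mult.commute)
    qed
    moreover have "ext \<phi> x = 0" if "x \<notin> M" for x using that by (simp add: ext_def)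
    ultimately show ?thesis unfolding subspace_dual_def by blast
  qed
  \<comment> \<open>Replacing the members of \<open>D\<close> by nearby restrictions of functionals on the whole space avoids
    extending them by the Hahn-Banach theorem.\<close>
  define near where "near = (\<lambda>(g, k::nat) \<phi>. bounded_linear \<phi> \<and> subspace_dual_norm M (\<lambda>x. ext \<phi> x - g x) < 1 / real (Suc k))"
  \<comment> \<open>The default 0 keeps \<open>\<psi> p\<close> bounded and linear when no
    functional is near.\<close>
  define \<psi> where "\<psi> p = (if Ex (near p) then Eps (near p) else (\<lambda>_. 0))" for p
  have near\<psi>: "near p (\<psi> p)" if "near p \<phi>" for p \<phi>
    unfolding \<psi>_def using that someI[of "near p" \<phi>] by auto
  have \<psi>: "bounded_linear (\<psi> p)" for p
  proof (cases "Ex (near p)")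
    case True
    then have "near p (\<psi> p)" using near\<psi> by blast
    then show ?thesis by (auto simp: near_def split: prod.splits)
  next
    case False
    then show ?thesis by (simp only: \<psi>_def if_False bounded_linear_zero)
  qed
  define P where "P = from_nat_into (\<psi> ` (D \<times> UNIV))"
  have "D \<noteq> {}" using D(3)[OF ext[OF bounded_linear_zero], of 1] by auto
  then have ran: "range P = \<psi> ` (D \<times> UNIV)"
    unfolding P_def using D(1) by (intro range_from_nat_into) auto
  show ?thesis
  proof (intro exI[of _ P] conjI allI impI)
    show "bounded_linear (P j)" for j
    proof -
      have "P j \<in> \<psi> ` (D \<times> UNIV)" unfolding ran[symmetric] by simp
      then obtain p where "P j = \<psi> p" by force
      then show ?thesis using \<psi>[of p] by simp
    qed
    fix \<phi> :: "'a \<Rightarrow> real" and e :: real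
    assume bl: "bounded_linear \<phi>" and "e > 0"
    \<comment> \<open>Half of \<open>e\<close> suffices for each, since both \<open>\<phi>\<close>
      and the chosen \<open>P j\<close> are compared with the same \<open>g\<close>.\<close>
    then obtain k where k: "inverse (real (Suc k)) < e / 2"
      using reals_Archimedean[of "e / 2"] by auto
    obtain g where g: "g \<in> D" "subspace_dual_norm M (\<lambda>x. ext \<phi> x - g x) < 1 / real (Suc k)"
      using D(3)[OF ext[OF bl], of "1 / real (Suc k)"] by auto
    then have "near (g, k) \<phi>" using bl by (simp add: near_def)
    then have n\<psi>: "near (g, k) (\<psi> (g, k))" by (rule near\<psi>)
    have "\<psi> (g, k) \<in> range P" unfolding ran using g(1) by blast
    then obtain j where j: "P j = \<psi> (g, k)" by force
    have gM: "g \<in> subspace_dual M" using g(1) D(2) by blast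
    have "\<bar>\<phi> x - P j x\<bar> \<le> e * norm x" if x: "x \<in> span A" for x
    proof -
      have Jx: "J x \<in> M" using x by (simp add: M_def)
      have *: "\<bar>h x - g (J x)\<bar> \<le> e / 2 * norm x" if "near (g, k) h" for h
      proof -
        have b: "bounded_linear h" and s: "subspace_dual_norm M (\<lambda>x. ext h x - g x) < 1 / real (Suc k)"
          using that by (auto simp: near_def)
        have "\<bar>ext h (J x) - g (J x)\<bar> \<le> subspace_dual_norm M (\<lambda>x. ext h x - g x) * norm (J x)"
          using subspace_dual_bound[OF subspace_dual_diff[OF ext[OF b] gM] subM Jx] .
        also have "\<dots> \<le> e / 2 * norm (J x)" using s k by (intro mult_right_mono) (auto simp: inverse_eq_divide)
        finally show ?thesis by (simp add: extJ[OF x] nrm)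
      qed
      show ?thesis using *[OF \<open>near (g, k) \<phi>\<close>] *[OF n\<psi>] unfolding j by linarith
    qed
    then show "\<exists>j. \<forall>x\<in>span A. \<bar>\<phi> x - P j x\<bar> \<le> e * norm x" by blast
  qed
qed

lemma weak_afpp_asplund:
  fixes J :: "'a::real_normed_vector \<Rightarrow> 'b::banach" and \<tau> :: "'a topology"
  assumes J: "completion_embedding J" and asp: "asplund_space TYPE('b)"
    and \<tau>: "tvs \<tau>" and dual: "tvs_dual \<tau> = tvs_dual euclidean"
  shows "weak_afpp \<tau>"
  unfolding afpp_def afpp_on_def
proof (intro allI impI, elim conjE)
  fix C f
  assume C: "C \<noteq> {}" "tvs_bounded \<tau> C" "convex C"
    and f: "continuous_map (subtopology \<tau> C) (subtopology \<tau> C) f"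
  have bl: "\<phi> \<in> tvs_dual \<tau> \<longleftrightarrow> bounded_linear \<phi>" for \<phi> :: "'a \<Rightarrow> real"
    by (simp add: dual tvs_dual_euclidean)
  have bd: "bounded (\<phi> ` C)" if "\<phi> \<in> tvs_dual \<tau>" for \<phi>
    using that \<tau> C(2) by (rule bounded_image_tvs_dual)
  then have "bounded C"
    by (rule weakly_bounded_imp_bounded) (simp add: bl blinfun.bounded_linear_right)
  then obtain R where R: "R > 0" "\<And>x. x \<in> C \<Longrightarrow> norm x \<le> R" by (meson bounded_pos)
  have "f ` C \<subseteq> C" using continuous_map_image_subset_topspace[OF f] \<tau> by (simp add: tvs_def)
  then obtain A where A: "countable A" "A \<noteq> {}" "A \<subseteq> C" "f ` A \<subseteq> A" "rationally_convex A"
    using countable_invariant_rationally_convex C(1,3) by metis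
  obtain P :: "nat \<Rightarrow> 'a \<Rightarrow> real" where P: "\<forall>j. bounded_linear (P j)"
    "\<forall>\<phi>. bounded_linear \<phi> \<longrightarrow> (\<forall>e>0. \<exists>j. \<forall>x\<in>span A. \<bar>\<phi> x - P j x\<bar> \<le> e * norm x)"
    using asplund_separable_restrictions[OF J asp A(1)] by blast
  \<comment> \<open>Diagonal choice: stage \<open>n\<close> treats the first \<open>n + 1\<close>
    functionals with tolerance \<open>1 / (n + 1)\<close>.\<close>
  have "\<exists>a. a \<in> A \<and> (\<forall>j\<le>n. \<bar>P j (a - f a)\<bar> < 1 / real (Suc n))" for n
  proof -
    have "\<exists>a\<in>A. \<forall>\<phi>\<in>P ` {..n}. \<bar>\<phi> (a - f a)\<bar> < 1 / real (Suc n)"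
      using P(1) bd
      by (intro approximate_fixed_point_finite_functionals[OF \<tau> C(3) f A(2-5)]) (auto simp: bl)
    then show ?thesis by auto
  qed
  then obtain a where a: "\<And>n. a n \<in> A" "\<And>n j. j \<le> n \<Longrightarrow> \<bar>P j (a n - f (a n))\<bar> < 1 / real (Suc n)"
    by metis
  define d where "d n = a n - f (a n)" for n
  \<comment> \<open>Invariance of \<open>A\<close> under \<open>f\<close> is what places the
    differences where the \<open>P j\<close> approximate.\<close>
  have "d n \<in> span A" for n
    unfolding d_def using a(1)[of n] A(4) by (intro span_diff span_base) auto
  moreover have "norm (d n) \<le> 2 * R" for n
  proof -
    have "a n \<in> C" "f (a n) \<in> C" using a(1)[of n] A(3,4) by auto
    then show ?thesis using R(2)[of "a n"] R(2)[of "f (a n)"] norm_triangle_ineq4[of "a n" "f (a n)"]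
      by (simp add: d_def)
  qed
  ultimately have d: "d n \<in> span A" "norm (d n) \<le> 2 * R" for n by blast+
  have "(\<lambda>n. \<phi> (d n)) \<longlonglongrightarrow> 0" if \<phi>: "bounded_linear \<phi>" for \<phi> :: "'a \<Rightarrow> real"
  proof (rule LIMSEQ_I)
    fix e :: real assume "e > 0"
    \<comment> \<open>As \<open>norm (d n) \<le> 2 * R\<close>, this accuracy leaves an error of at
      most \<open>e / 2\<close>.\<close>
    obtain j where j: "\<forall>x\<in>span A. \<bar>\<phi> x - P j x\<bar> \<le> e / (4 * R) * norm x"
      using P(2)[rule_format, OF \<phi>, of "e / (4 * R)"] \<open>e > 0\<close> R(1) by auto
    obtain k where k: "inverse (real (Suc k)) < e / 2"
      using reals_Archimedean[of "e / 2"] \<open>e > 0\<close> by auto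
    have "norm (\<phi> (d n) - 0) < e" if "n \<ge> max j k" for n
    proof -
      have "\<bar>\<phi> (d n) - P j (d n)\<bar> \<le> e / (4 * R) * norm (d n)" using j d(1) by blast
      also have "\<dots> \<le> e / (4 * R) * (2 * R)" using d(2) \<open>e > 0\<close> R(1) by (intro mult_left_mono) auto
      also have "\<dots> = e / 2" using R(1) by simp
      finally have "\<bar>\<phi> (d n) - P j (d n)\<bar> \<le> e / 2" .
      moreover have "\<bar>P j (d n)\<bar> < 1 / real (Suc n)" using a(2)[of j n] that by (simp add: d_def)
      moreover have "1 / real (Suc n) \<le> 1 / real (Suc k)" using that by (intro divide_left_mono) auto
      ultimately show ?thesis using k unfolding inverse_eq_divide real_norm_def diff_0_right by linarith
    qed
    then show "\<exists>m. \<forall>n\<ge>m. norm (\<phi> (d n) - 0) < e" by blast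
  qed
  then show "\<exists>x. (\<forall>n. x n \<in> C) \<and> (\<forall>\<phi>\<in>tvs_dual \<tau>. (\<lambda>n. \<phi> (x n - f (x n))) \<longlonglongrightarrow> 0)"
    using a(1) A(3) by (intro exI[of _ a]) (auto simp: bl d_def)
qed

section \<open>The monolithic case\<close>

lemma tvs_euclidean: "tvs (euclidean :: 'a::real_normed_vector topology)"
  unfolding tvs_def by (auto simp: case_prod_beta intro!: continuous_intros)

text \<open>The dual ball is cut out by closed conditions on single evaluations; for negative radius
  it is empty.\<close>

lemma weak_star_closed_cball:
  "closedin weak_star_topology (cball (0 :: 'a::real_normed_vector \<Rightarrow>\<^sub>L real) R)"
proof (cases "R \<ge> 0")
  case True
  have ev: "continuous_map weak_star_topology euclideanreal (\<lambda>\<phi>::'a \<Rightarrow>\<^sub>L real. \<bar>\<phi> x\<bar>)" for x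
    by (intro continuous_map_real_abs strong_operator_topology_continuous_evaluation)
  have "closedin weak_star_topology {\<phi>::'a \<Rightarrow>\<^sub>L real. \<phi> \<in> topspace weak_star_topology \<and> \<bar>\<phi> x\<bar> \<in> {..R * norm x}}" for x
    by (rule closedin_continuous_map_preimage[OF ev]) auto
  then have "closedin weak_star_topology
      (\<Inter>x. {\<phi>::'a \<Rightarrow>\<^sub>L real. \<phi> \<in> topspace weak_star_topology \<and> \<bar>\<phi> x\<bar> \<in> {..R * norm x}})"
    by (intro closedin_INT) auto
  also have "(\<Inter>x. {\<phi>::'a \<Rightarrow>\<^sub>L real. \<phi> \<in> topspace weak_star_topology \<and> \<bar>\<phi> x\<bar> \<in> {..R * norm x}}) = cball 0 R"
  proof -
    have "(\<forall>x. \<bar>\<phi> x\<bar> \<le> R * norm x) \<longleftrightarrow> norm \<phi> \<le> R" for \<phi> :: "'a \<Rightarrow>\<^sub>L real"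
    proof
      assume "norm \<phi> \<le> R"
      show "\<forall>x. \<bar>\<phi> x\<bar> \<le> R * norm x"
      proof
        fix x
        have "\<bar>\<phi> x\<bar> \<le> norm \<phi> * norm x" using norm_blinfun[of \<phi> x] by simp
        also have "\<dots> \<le> R * norm x" using \<open>norm \<phi> \<le> R\<close> by (rule mult_right_mono) simp
        finally show "\<bar>\<phi> x\<bar> \<le> R * norm x" .
      qed
    qed (use True in \<open>auto intro: norm_blinfun_bound\<close>)
    then show ?thesis
      by (simp add: strong_operator_topology_topspace set_eq_iff)
  qed
  finally show ?thesis .
qed simp

lemma weak_star_afpp_aleph0_monolithic:
  assumes mono: "aleph0_monolithic (weak_star_topology :: ('a::real_normed_vector \<Rightarrow>\<^sub>L real) topology)"
  shows "afpp (euclidean :: ('a \<Rightarrow>\<^sub>L real) topology) canonical_functionals"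
  unfolding afpp_def afpp_on_def
proof (intro allI impI, elim conjE)
  fix C :: "('a \<Rightarrow>\<^sub>L real) set" and f
  assume C: "C \<noteq> {}" "tvs_bounded euclidean C" "convex C"
    and f: "continuous_map (top_of_set C) (top_of_set C) f"
  have "bounded C" using C(2) by (simp add: tvs_bounded_euclidean)
  then obtain R where R: "\<And>x. x \<in> C \<Longrightarrow> norm x \<le> R" by (meson bounded_pos)
  have "f ` C \<subseteq> C" using continuous_map_image_subset_topspace[OF f] by simp
  then obtain A where A: "countable A" "A \<noteq> {}" "A \<subseteq> C" "f ` A \<subseteq> A" "rationally_convex A"
    using countable_invariant_rationally_convex C(1,3) by metis
  define D where "D = (\<lambda>a. a - f a) ` A"
  define K where "K = weak_star_topology closure_of D"
  have DK: "D \<subseteq> K"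
    unfolding K_def by (rule closure_of_subset) (simp add: strong_operator_topology_topspace)
  have "D \<subseteq> cball 0 (2 * R)"
  proof -
    have "norm (a - f a) \<le> 2 * R" if "a \<in> A" for a
    proof -
      have "a \<in> C" "f a \<in> C" using that A(3,4) by auto
      then show ?thesis using R[of a] R[of "f a"] norm_triangle_ineq4[of a "f a"] by simp
    qed
    then show ?thesis by (auto simp: D_def)
  qed
  then have "K \<subseteq> cball 0 (2 * R)"
    unfolding K_def using weak_star_closed_cball by (rule closure_of_minimal)
  then have "bounded K" by (rule bounded_subset[OF bounded_cball])
  then have compact: "compactin weak_star_topology K"
    unfolding K_def by (intro weak_star_compact) auto
  \<comment> \<open>The countable set \<open>D\<close> is dense in its own closure, so monolithicity
    applies to \<open>K\<close>.\<close>
  have "separable_space (subtopology weak_star_topology K)"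
    unfolding separable_space_def
  proof (intro exI[of _ D] conjI)
    show "countable D" using A(1) by (simp add: D_def)
    show "D \<subseteq> topspace (subtopology weak_star_topology K)"
      using DK by (simp add: strong_operator_topology_topspace)
    show "subtopology weak_star_topology K closure_of D = topspace (subtopology weak_star_topology K)"
      using DK by (simp add: closure_of_subtopology strong_operator_topology_topspace Int_absorb1 flip: K_def)
  qed
  then have "has_countable_network (subtopology weak_star_topology K)"
    using mono by (simp add: aleph0_monolithic_def strong_operator_topology_topspace)
  then obtain Y :: "nat \<Rightarrow> 'a" where Y: "\<And>\<phi>. \<phi> \<in> K \<Longrightarrow> (\<And>k. blinfun_apply \<phi> (Y k) = 0) \<Longrightarrow> \<phi> = 0"
    using countable_network_separating_points by blast
  have bl: "bounded_linear (\<lambda>\<phi>::'a \<Rightarrow>\<^sub>L real. \<phi> x)" for x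
    by (rule blinfun.bounded_linear_left)
  have "\<exists>a. a \<in> A \<and> (\<forall>k\<le>n. \<bar>blinfun_apply (a - f a) (Y k)\<bar> < 1 / real (Suc n))" for n
  proof -
    \<comment> \<open>The map \<open>f\<close> is norm continuous, so the norm topology is used
      here; evaluations at the \<open>Y k\<close> belong to its dual.\<close>
    have "\<exists>a\<in>A. \<forall>\<phi>\<in>(\<lambda>k \<phi>. blinfun_apply \<phi> (Y k)) ` {..n}. \<bar>\<phi> (a - f a)\<bar> < 1 / real (Suc n)"
      using bl \<open>bounded C\<close>
      by (intro approximate_fixed_point_finite_functionals[OF tvs_euclidean C(3) f A(2-5)])
        (auto simp: tvs_dual_euclidean intro: bounded_linear_image)
    then show ?thesis by auto
  qed
  then obtain a where a: "\<And>n. a n \<in> A"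
    "\<And>n k. k \<le> n \<Longrightarrow> \<bar>blinfun_apply (a n - f (a n)) (Y k)\<bar> < 1 / real (Suc n)"
    by metis
  have "(\<lambda>n. blinfun_apply (a n - f (a n)) x) \<longlonglongrightarrow> 0" for x
    using compact _ Y a(2)
  proof (rule tendsto_zero_weak_star_compact)
    show "a n - f (a n) \<in> K" for n using a(1) DK by (auto simp: D_def)
  qed
  then show "\<exists>x. (\<forall>n. x n \<in> C) \<and> (\<forall>\<phi>\<in>canonical_functionals. (\<lambda>n. \<phi> (x n - f (x n))) \<longlonglongrightarrow> 0)"
    using a(1) A(3) by (intro exI[of _ a]) (auto simp: canonical_functionals_def)
qed

theorem proposition2p3:
  shows
    "((\<exists>J :: 'a::real_normed_vector \<Rightarrow> 'b::banach. completion_embedding J) \<and>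
        asplund_space TYPE('b) \<longrightarrow>
      (\<forall>\<tau> :: 'a topology.
         locally_convex_tvs \<tau> \<and> tvs_dual \<tau> = tvs_dual euclidean \<longrightarrow> weak_afpp \<tau>)) \<and>
     (aleph0_monolithic (weak_star_topology :: ('a \<Rightarrow>\<^sub>L real) topology) \<longrightarrow>
      afpp (euclidean :: ('a \<Rightarrow>\<^sub>L real) topology) canonical_functionals)"
proof (intro conjI impI allI)
  fix \<tau> :: "'a topology"
  assume "(\<exists>J :: 'a \<Rightarrow> 'b. completion_embedding J) \<and> asplund_space TYPE('b)"
    and \<tau>: "locally_convex_tvs \<tau> \<and> tvs_dual \<tau> = tvs_dual euclidean"
  then obtain J :: "'a \<Rightarrow> 'b" where "completion_embedding J" "asplund_space TYPE('b)" by blast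
  then show "weak_afpp \<tau>"
    using \<tau> by (intro weak_afpp_asplund) (auto simp: locally_convex_tvs_def)
qed (rule weak_star_afpp_aleph0_monolithic)

end
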